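(* Let $\omega=\pi/2$. There exists an adaptive probing strategy which, for every $n$ and every convex polygon $\mathcal{O}$ with $n$ vertices all of whose internal angles are strictly larger than $\pi/2$, determines $\mathcal{O}$ exactly (all its vertices) using at most $2n-3$ $\omega$-probes.
   Context: An $\omega$-wedge $\mathcal{W}(\omega,q,H_1,H_2)$ is the closed region formed by a point $q$ (the apex), two rays $H_1,H_2$ emanating from $q$ with angle $\omega$ between them such that $H_2$ is obtained from $H_1$ by a counterclockwise rotation by $\omega$, and all points between them. A valid $\omega$-probe of a convex polygon $\mathcal{O}$ with respect to a directed line $\overrightarrow{L}$ is an $\omega$-wedge containing $\mathcal{O}$, each of whose rays contains at least one point of $\mathcal{O}$, whose apex $q$ lies on $\overrightarrow{L}$, and such that the ray from $q$ in the direction of $\overrightarrow{L}$ intersects $\mathcal{O}$. Probing model: $\mathcal{O}$ is unknown to the prober, who knows only a point $p\in\mathcal{O}$ and a circle $\Psi$ with $\mathcal{O}$ contained in the disk bounded by $\Psi$ (the number $n$ of vertices is not known). One $\omega$-probe consists of the prober choosing a directed line $\overrightarrow{L}$; if a valid $\omega$-probe of $\mathcal{O}$ with respect to $\overrightarrow{L}$ exists, the prober receives its apex $q$, its rays $H_1,H_2$, and the points $p_1\in\mathcal{O}\cap H_1$, $p_2\in\mathcal{O}\cap H_2$ closest to $q$; otherwise the prober is told only that the probe missed $\mathcal{O}$. A strategy is adaptive: each chosen line may depend on all previous outcomes. *)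

theory Defs
  imports "HOL-Analysis.Analysis"
begin

definition cross2 :: "complex \<Rightarrow> complex \<Rightarrow> real" where
  "cross2 u w = Im (cnj u * w)"

definition vec_angle :: "complex \<Rightarrow> complex \<Rightarrow> real" where
  "vec_angle u w = arccos ((u \<bullet> w) / (norm u * norm w))"

text \<open>A list of vertices of a convex polygon in counterclockwise order, every
  listed point being a genuine (strictly convex) vertex: for every edge, all other
  vertices lie strictly to its left.\<close>
definition convex_polygon_ccw :: "complex list \<Rightarrow> bool" where
  "convex_polygon_ccw vs \<longleftrightarrow> length vs \<ge> 3 \<and> distinct vs \<and>
     (\<forall>i < length vs. \<forall>j < length vs. j \<noteq> i \<and> j \<noteq> Suc i mod length vs \<longrightarrow>
        cross2 (vs ! (Suc i mod length vs) - vs ! i) (vs ! j - vs ! i) > 0)"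

definition internal_angle :: "complex list \<Rightarrow> nat \<Rightarrow> real" where
  "internal_angle vs i =
     (let n = length vs in
      vec_angle (vs ! ((i + n - 1) mod n) - vs ! i) (vs ! (Suc i mod n) - vs ! i))"

definition ray :: "complex \<Rightarrow> complex \<Rightarrow> complex set" where
  "ray q d = {q + of_real s * d | s. s \<ge> 0}"

text \<open>The omega-wedge with apex q, first ray in direction d, second ray obtained
  by counterclockwise rotation by omega (for 0 < omega < pi: the closed cone).\<close>
definition wedge :: "real \<Rightarrow> complex \<Rightarrow> complex \<Rightarrow> complex set" where
  "wedge \<omega> q d = {q + of_real s * d + of_real t * (cis \<omega> * d) | s t. s \<ge> 0 \<and> t \<ge> 0}"

text \<open>A directed line: a point on it and a (nonzero) direction.\<close>
type_synonym dline = "complex \<times> complex"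

definition on_line :: "dline \<Rightarrow> complex \<Rightarrow> bool" where
  "on_line L q \<longleftrightarrow> (\<exists>t::real. q = fst L + of_real t * snd L)"

definition valid_probe :: "real \<Rightarrow> complex set \<Rightarrow> dline \<Rightarrow> complex \<Rightarrow> complex \<Rightarrow> bool" where
  "valid_probe \<omega> Ob L q d \<longleftrightarrow> d \<noteq> 0 \<and> Ob \<subseteq> wedge \<omega> q d \<and>
     Ob \<inter> ray q d \<noteq> {} \<and> Ob \<inter> ray q (cis \<omega> * d) \<noteq> {} \<and>
     on_line L q \<and> ray q (snd L) \<inter> Ob \<noteq> {}"

definition closest_on :: "complex set \<Rightarrow> complex \<Rightarrow> complex \<Rightarrow> bool" where
  "closest_on S q x \<longleftrightarrow> x \<in> S \<and> (\<forall>y\<in>S. dist q x \<le> dist q y)"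

text \<open>Outcome of a probe: a miss, or apex, the two rays, and the points of Ob
  on each ray closest to the apex.\<close>
datatype outcome = Miss | Hit complex "complex set" "complex set" complex complex

definition valid_response :: "real \<Rightarrow> complex set \<Rightarrow> dline \<Rightarrow> outcome \<Rightarrow> bool" where
  "valid_response \<omega> Ob L r = (case r of
      Miss \<Rightarrow> \<not> (\<exists>q d. valid_probe \<omega> Ob L q d)
    | Hit q H1 H2 p1 p2 \<Rightarrow> (\<exists>d. valid_probe \<omega> Ob L q d \<and> H1 = ray q d \<and>
          H2 = ray q (cis \<omega> * d) \<and> closest_on (Ob \<inter> H1) q p1 \<and> closest_on (Ob \<inter> H2) q p2))"

type_synonym history = "(dline \<times> outcome) list"

datatype action = Probe dline | Answer "complex set"

text \<open>A strategy (already given the known point p and circle) maps the history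
  of probes/outcomes to the next action.  The responder may be adversarial and
  history dependent, but must always give a valid response.
  solves S ans h k V: starting from history h, the strategy announces V after
  at most k further probes, each along a genuine directed line.\<close>
fun solves :: "(history \<Rightarrow> action) \<Rightarrow> (history \<Rightarrow> dline \<Rightarrow> outcome) \<Rightarrow> history
    \<Rightarrow> nat \<Rightarrow> complex set \<Rightarrow> bool" where
  "solves S ans h 0 V = (S h = Answer V)"
| "solves S ans h (Suc k) V = (case S h of
      Answer W \<Rightarrow> W = V
    | Probe L \<Rightarrow> snd L \<noteq> 0 \<and> solves S ans (h @ [(L, ans h L)]) k V)"

end

theory Submission
  imports Defs
begin

text \<open>
  Probe along the line through two known vertices \<open>w\<close> and \<open>u\<close> that are consecutive among the
  known ones. Either the second ray of the wedge is flush with the line, so that the edge from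
  \<open>u\<close> to \<open>w\<close> is confirmed, or its contact point lies strictly beyond the line and is a new vertex.
  Counting known vertices and confirmed edges, every such probe gains at least one of the
  \<open>2 * n\<close> items, the first probe gains two contact points \<open>A\<close>, \<open>B\<close>, and the probe from \<open>A\<close>
  to \<open>B\<close> gains two items as well, because its first contact point \<open>C\<close> is new in any case. For a
  total of \<open>2 * n - 3\<close> probes this leaves one more double gain to be found. It comes from probing
  the gap that ends in \<open>C\<close> again and again: as long as the first contact point is not new it is
  \<open>C\<close> itself, which is impossible when the edge into \<open>C\<close> is finally confirmed. The assumption
  on the angles enters only through the fact that no right-angled wedge with apex at a vertex
  contains the polygon.
\<close>

section \<open>Right-angled wedges and existence of probes\<close>

lemma cross2_alt: "cross2 u w = Re u * Im w - Im u * Re w"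
  by (simp add: cross2_def)

text \<open>\<open>d\<close> and \<open>\<i> * d\<close> are orthogonal and of equal length, so
  \<open>d \<bullet> z\<close> and \<open>cross2 d z\<close> are the coordinates of \<open>z\<close>
  in this frame up to the factor \<open>(norm d)\<^sup>2\<close>. Right-angled wedges thereby become
  sign conditions on two linear forms.\<close>

lemma frame_expansion:
  assumes "d \<noteq> 0"
  shows "z = of_real (d \<bullet> z / (norm d)\<^sup>2) * d + of_real (cross2 d z / (norm d)\<^sup>2) * (\<i> * d)"
proof -
  define N where "N = (norm d)\<^sup>2"
  have N: "N \<noteq> 0" "N = Re d * Re d + Im d * Im d"
    using assms by (simp add: N_def, simp add: N_def cmod_power2 power2_eq_square[of "Re d"] power2_eq_square[of "Im d"])
  have "of_real N * z = of_real (d \<bullet> z) * d + of_real (cross2 d z) * (\<i> * d)"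
    unfolding N(2) by (simp add: complex_eq_iff inner_complex_def cross2_alt algebra_simps)
  then have "z = (of_real (d \<bullet> z) * d + of_real (cross2 d z) * (\<i> * d)) / of_real N"
    using N(1) by (simp add: field_simps)
  then show ?thesis by (simp add: N_def add_divide_distrib)
qed

lemma cross2_ii: "cross2 (\<i> * d) w = - (d \<bullet> w)" "(\<i> * d) \<bullet> w = cross2 d w"
  by (simp_all add: cross2_alt inner_complex_def)

lemma frame_eq_0:
  assumes "d \<noteq> 0" "d \<bullet> z = 0" "cross2 d z = 0"
  shows "z = 0"
  using frame_expansion[OF assms(1), of z] assms by simp

lemma wedge_iff:
  assumes "d \<noteq> 0"
  shows "z \<in> wedge (pi/2) q d \<longleftrightarrow> 0 \<le> d \<bullet> (z - q) \<and> 0 \<le> cross2 d (z - q)"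
proof
  assume "z \<in> wedge (pi/2) q d"
  then obtain s t where st: "s \<ge> 0" "t \<ge> 0" "z - q = of_real s * d + of_real t * (\<i> * d)"
    by (auto simp: wedge_def)
  have "d \<bullet> (z - q) = s * (norm d)\<^sup>2" "cross2 d (z - q) = t * (norm d)\<^sup>2"
    unfolding st(3) by (simp_all add: inner_complex_def cross2_alt cmod_power2[unfolded power2_eq_square] power2_eq_square algebra_simps)
  with st show "0 \<le> d \<bullet> (z - q) \<and> 0 \<le> cross2 d (z - q)" by simp
next
  assume "0 \<le> d \<bullet> (z - q) \<and> 0 \<le> cross2 d (z - q)"
  moreover have "z = q + of_real (d \<bullet> (z - q) / (norm d)\<^sup>2) * d
      + of_real (cross2 d (z - q) / (norm d)\<^sup>2) * (\<i> * d)"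
    using frame_expansion[OF assms, of "z - q"] by (metis add.assoc add.commute diff_add_cancel)
  moreover have "d \<bullet> (z - q) / (norm d)\<^sup>2 \<ge> 0" "cross2 d (z - q) / (norm d)\<^sup>2 \<ge> 0"
    using calculation(1) by auto
  ultimately show "z \<in> wedge (pi/2) q d"
    unfolding wedge_def cis_pi_half by blast
qed

lemma ray_iff:
  assumes "d \<noteq> 0"
  shows "z \<in> ray q d \<longleftrightarrow> 0 \<le> d \<bullet> (z - q) \<and> cross2 d (z - q) = 0"
proof
  assume "z \<in> ray q d"
  then obtain s where st: "s \<ge> 0" "z - q = of_real s * d"
    by (auto simp: ray_def)
  have "d \<bullet> (z - q) = s * (norm d)\<^sup>2" "cross2 d (z - q) = 0"
    unfolding st(2) by (simp_all add: inner_complex_def cross2_alt cmod_power2[unfolded power2_eq_square] power2_eq_square algebra_simps)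
  with st show "0 \<le> d \<bullet> (z - q) \<and> cross2 d (z - q) = 0" by simp
next
  assume "0 \<le> d \<bullet> (z - q) \<and> cross2 d (z - q) = 0"
  moreover from this have "z = q + of_real (d \<bullet> (z - q) / (norm d)\<^sup>2) * d"
    using frame_expansion[OF assms, of "z - q"] by (simp add: algebra_simps)
  moreover have "d \<bullet> (z - q) / (norm d)\<^sup>2 \<ge> 0"
    using calculation(1) by auto
  ultimately show "z \<in> ray q d"
    unfolding ray_def by blast
qed

lemma ray_ii_iff:
  assumes "d \<noteq> 0"
  shows "z \<in> ray q (\<i> * d) \<longleftrightarrow> 0 \<le> cross2 d (z - q) \<and> d \<bullet> (z - q) = 0"
  using assms by (simp add: ray_iff cross2_ii)

section \<open>Supporting right-angled wedges of a finite point set\<close>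

lemma inner_ge_on_hull:
  fixes X :: "complex set"
  assumes "\<And>y. y \<in> X \<Longrightarrow> m \<le> a \<bullet> y" "z \<in> convex hull X"
  shows "m \<le> a \<bullet> z"
proof -
  have "convex hull X \<subseteq> {y. m \<le> a \<bullet> y}"
    by (rule hull_minimal) (use assms(1) convex_halfspace_ge[of m a] in \<open>auto\<close>)
  with assms(2) show ?thesis by auto
qed

lemma cross2_ge_on_hull:
  fixes X :: "complex set"
  assumes "\<And>y. y \<in> X \<Longrightarrow> m \<le> cross2 a y" "z \<in> convex hull X"
  shows "m \<le> cross2 a z"
  using inner_ge_on_hull[of X m "\<i> * a" z] assms by (simp add: cross2_ii)

lemma continuous_on_Min_family:
  fixes f :: "'a \<Rightarrow> 'b::topological_space \<Rightarrow> real"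
  assumes "finite X" "X \<noteq> {}" "\<And>y. y \<in> X \<Longrightarrow> continuous_on T (f y)"
  shows "continuous_on T (\<lambda>t. Min ((\<lambda>y. f y t) ` X))"
  using assms
proof (induction X rule: finite_ne_induct)
  case (insert x F)
  have "(\<lambda>t. Min ((\<lambda>y. f y t) ` insert x F)) = (\<lambda>t. min (f x t) (Min ((\<lambda>y. f y t) ` F)))"
    using insert.hyps by simp
  then show ?case using insert by (auto intro!: continuous_on_min)
qed simp

text \<open>A line through a point of the hull never misses. For each angle \<open>t\<close> the two
  supporting lines in the frame \<open>D t\<close> meet in one apex; as \<open>t\<close> runs from 0
  to a right angle, this apex has to meet the probing line by the intermediate value
  theorem.\<close>

lemma valid_probe_exists:
  fixes X :: "complex set"
  assumes fin: "finite X" and x: "x \<in> convex hull X" and v: "v \<noteq> 0"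
  shows "\<exists>q d. valid_probe (pi/2) (convex hull X) (x, v) q d"
proof -
  have ne: "X \<noteq> {}" using x by auto
  define D where "D t = v * cis (- t)" for t
  define h1 where "h1 t = Min ((\<lambda>y. cross2 (D t) (y - x)) ` X)" for t
  define h2 where "h2 t = Min ((\<lambda>y. D t \<bullet> (y - x)) ` X)" for t
  have D0: "D t \<noteq> 0" for t using v by (simp add: D_def)
  have Dv: "cross2 (D t) v = (norm v)\<^sup>2 * sin t" "D t \<bullet> v = (norm v)\<^sup>2 * cos t" for t
    by (simp_all add: D_def cross2_alt inner_complex_def cmod_power2[unfolded power2_eq_square] power2_eq_square algebra_simps)
  have le1: "h1 t \<le> cross2 (D t) (y - x)" if "y \<in> convex hull X" for t y
  proof -
    have "h1 t + cross2 (D t) x \<le> cross2 (D t) y"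
    proof (rule cross2_ge_on_hull[OF _ that])
      fix z assume "z \<in> X"
      then have "h1 t \<le> cross2 (D t) (z - x)" unfolding h1_def using fin by auto
      then show "h1 t + cross2 (D t) x \<le> cross2 (D t) z" by (simp add: cross2_alt algebra_simps)
    qed
    then show ?thesis by (simp add: cross2_alt algebra_simps)
  qed
  have le2: "h2 t \<le> D t \<bullet> (y - x)" if "y \<in> convex hull X" for t y
  proof -
    have "h2 t + D t \<bullet> x \<le> D t \<bullet> y"
    proof (rule inner_ge_on_hull[OF _ that])
      fix z assume "z \<in> X"
      then have "h2 t \<le> D t \<bullet> (z - x)" unfolding h2_def using fin by auto
      then show "h2 t + D t \<bullet> x \<le> D t \<bullet> z" by (simp add: inner_diff_right)
    qed
    then show ?thesis by (simp add: inner_diff_right)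
  qed
  have at1: "\<exists>y\<in>X. cross2 (D t) (y - x) = h1 t" for t
  proof -
    have "h1 t \<in> (\<lambda>y. cross2 (D t) (y - x)) ` X" unfolding h1_def using fin ne by (intro Min_in) auto
    then show ?thesis by auto
  qed
  have at2: "\<exists>y\<in>X. D t \<bullet> (y - x) = h2 t" for t
  proof -
    have "h2 t \<in> (\<lambda>y. D t \<bullet> (y - x)) ` X" unfolding h2_def using fin ne by (intro Min_in) auto
    then show ?thesis by auto
  qed
  have neg: "h1 t \<le> 0" "h2 t \<le> 0" for t
    using le1[OF x, of t] le2[OF x, of t] by (simp_all add: cross2_def)
  have c1: "continuous_on {0..pi/2} h1" unfolding h1_def D_def cross2_def
    by (rule continuous_on_Min_family[OF fin ne]) (intro continuous_intros)
  have c2: "continuous_on {0..pi/2} h2" unfolding h2_def D_def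
    by (rule continuous_on_Min_family[OF fin ne]) (intro continuous_intros)
  \<comment> \<open>Up to a positive factor this is the signed position of the apex relative to the
    line through \<open>x\<close> in direction \<open>v\<close>; its signs at the two ends follow
    from \<open>neg\<close>.\<close>
  define F where "F t = h1 t * cos t - h2 t * sin t" for t
  have cF: "continuous_on {0..pi/2} F" unfolding F_def by (intro continuous_intros c1 c2)
  have "\<exists>t. 0 \<le> t \<and> t \<le> pi/2 \<and> F t = 0"
    by (rule IVT') (use neg[of 0] neg[of "pi/2"] cF in \<open>auto simp: F_def\<close>)
  then obtain t where t: "0 \<le> t" "t \<le> pi/2" and Ft: "F t = 0" by blast
  \<comment> \<open>\<open>F t = 0\<close> makes \<open>(h2 t, h1 t)\<close> a multiple of
    \<open>(cos t, sin t)\<close>, which is \<open>v\<close> in the frame up to a factor. That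
    multiple is \<open>- k\<close>, and \<open>k \<ge> 0\<close> places the apex behind
    \<open>x\<close>.\<close>
  define k where "k = - (h1 t * sin t + h2 t * cos t)"
  have sc: "sin t \<ge> 0" "cos t \<ge> 0" using t by (auto intro: sin_ge_zero cos_ge_zero)
  have k0: "k \<ge> 0" unfolding k_def
    using mult_nonpos_nonneg[OF neg(1)[of t] sc(1)] mult_nonpos_nonneg[OF neg(2)[of t] sc(2)] by simp
  have sc1: "sin t * sin t + cos t * cos t = 1"
    using sin_cos_squared_add[of t] by (simp add: power2_eq_square)
  have e1: "h1 t = - k * sin t"
  proof -
    have "k * sin t = - (h1 t * (sin t * sin t) + (h2 t * sin t) * cos t)" by (simp add: k_def algebra_simps)
    also have "h2 t * sin t = h1 t * cos t" using Ft by (simp add: F_def)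
    also have "- (h1 t * (sin t * sin t) + h1 t * cos t * cos t) = - (h1 t * (sin t * sin t + cos t * cos t))"
      by (simp only: distrib_left mult.assoc)
    finally show ?thesis unfolding sc1 by simp
  qed
  have e2: "h2 t = - k * cos t"
  proof -
    have "k * cos t = - ((h1 t * cos t) * sin t + h2 t * (cos t * cos t))" by (simp add: k_def algebra_simps)
    also have "h1 t * cos t = h2 t * sin t" using Ft by (simp add: F_def)
    also have "- (h2 t * sin t * sin t + h2 t * (cos t * cos t)) = - (h2 t * (sin t * sin t + cos t * cos t))"
      by (simp only: distrib_left mult.assoc)
    finally show ?thesis unfolding sc1 by simp
  qed
  define q where "q = x - of_real (k / (norm v)\<^sup>2) * v"
  have nv: "(norm v)\<^sup>2 > 0" using v by simp
  have "cross2 (D t) (q - x) = - (k / (norm v)\<^sup>2) * cross2 (D t) v"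
    by (simp add: q_def cross2_alt algebra_simps)
  then have q1: "cross2 (D t) (q - x) = h1 t" using nv e1 by (simp add: Dv)
  have "D t \<bullet> (q - x) = - (k / (norm v)\<^sup>2) * (D t \<bullet> v)"
    by (simp add: q_def inner_complex_def algebra_simps)
  then have q2: "D t \<bullet> (q - x) = h2 t" using nv e2 by (simp add: Dv)
  have r1: "cross2 (D t) (y - q) = cross2 (D t) (y - x) - h1 t" for y
    using q1 by (simp add: cross2_alt algebra_simps)
  have r2: "D t \<bullet> (y - q) = D t \<bullet> (y - x) - h2 t" for y
    using q2 by (simp add: inner_diff_right)
  have sub: "convex hull X \<subseteq> wedge (pi/2) q (D t)"
    using le1[of _ t] le2[of _ t] D0 by (auto simp: wedge_iff r1 r2)
  have XX: "X \<subseteq> convex hull X" by (rule hull_subset)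
  obtain y1 where "y1 \<in> X" "cross2 (D t) (y1 - x) = h1 t" using at1 by blast
  then have "y1 \<in> convex hull X \<inter> ray q (D t)"
    using XX le2[of y1 t] D0 by (auto simp: ray_iff r1 r2)
  moreover obtain y2 where "y2 \<in> X" "D t \<bullet> (y2 - x) = h2 t" using at2 by blast
  then have "y2 \<in> convex hull X \<inter> ray q (cis (pi/2) * D t)"
    using XX le1[of y2 t] D0 by (auto simp: ray_ii_iff r1 r2)
  moreover have "on_line (x, v) q"
    unfolding on_line_def by (intro exI[of _ "- (k / (norm v)\<^sup>2)"]) (simp add: q_def)
  moreover have "x \<in> ray q v" unfolding ray_def
    using k0 by (intro CollectI exI[of _ "k / (norm v)\<^sup>2"]) (simp add: q_def)
  ultimately have "valid_probe (pi/2) (convex hull X) (x, v) q (D t)"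
    unfolding valid_probe_def using sub D0 x by auto
  then show ?thesis by blast
qed

section \<open>Outcomes of probes\<close>

text \<open>The set lies on one side of the line of the ray, so a segment of the set with
  \<open>p\<close> in its interior runs along that line, where \<open>p\<close>, being nearest to
  \<open>q\<close>, cannot lie between two points. The alternatives in \<open>side\<close> serve the
  two rays of a wedge. Contact points are therefore vertices.\<close>

lemma closest_on_ray_extreme:
  assumes e: "e \<noteq> 0"
    and fwd: "\<And>y. y \<in> S \<Longrightarrow> 0 \<le> e \<bullet> (y - q)"
    and side: "(\<forall>y\<in>S. 0 \<le> cross2 e (y - q)) \<or> (\<forall>y\<in>S. cross2 e (y - q) \<le> 0)"
    and p: "closest_on (S \<inter> ray q e) q p"
  shows "p extreme_point_of S"
  unfolding extreme_point_of_def
proof (intro conjI ballI notI)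
  show pS: "p \<in> S" using p by (simp add: closest_on_def)
  have p0: "cross2 e (p - q) = 0" using p e by (simp add: closest_on_def ray_iff)
  fix x y assume x: "x \<in> S" and y: "y \<in> S" and "p \<in> open_segment x y"
  then obtain t where t: "0 < t" "t < 1" and pt: "p = (1 - t) *\<^sub>R x + t *\<^sub>R y" and "x \<noteq> y"
    by (auto simp: in_segment)
  have lin: "cross2 e (p - q) = (1 - t) * cross2 e (x - q) + t * cross2 e (y - q)"
    "e \<bullet> (p - q) = (1 - t) * (e \<bullet> (x - q)) + t * (e \<bullet> (y - q))"
    unfolding pt by (simp_all add: cross2_alt inner_complex_def algebra_simps)
  have cr: "cross2 e (x - q) = 0 \<and> cross2 e (y - q) = 0"
  proof -
    have "(1 - t) * cross2 e (x - q) + t * cross2 e (y - q) = 0" using lin p0 by simp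
    moreover have "0 \<le> cross2 e (x - q) \<and> 0 \<le> cross2 e (y - q) \<or> cross2 e (x - q) \<le> 0 \<and> cross2 e (y - q) \<le> 0"
      using side x y by auto
    ultimately show ?thesis using t
      by (smt (verit) mult_pos_pos mult_nonneg_nonneg mult_pos_neg mult_nonneg_nonpos)
  qed
  have far: "e \<bullet> (p - q) \<le> e \<bullet> (z - q)" if z: "z \<in> S" "cross2 e (z - q) = 0" for z
  proof -
    have dist: "dist q w = (e \<bullet> (w - q)) / norm e" if "w \<in> S" "cross2 e (w - q) = 0" for w
    proof -
      have w: "w - q = of_real (e \<bullet> (w - q) / (norm e)\<^sup>2) * e"
        using frame_expansion[OF e, of "w - q"] that by simp
      have "norm (w - q) = \<bar>e \<bullet> (w - q) / (norm e)\<^sup>2\<bar> * norm e"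
        by (subst w) (simp add: norm_mult del: of_real_divide)
      also have "\<dots> = (e \<bullet> (w - q)) / norm e"
        using fwd[OF that(1)] e by (simp add: power2_eq_square)
      finally show ?thesis by (simp add: dist_norm norm_minus_commute)
    qed
    have "z \<in> S \<inter> ray q e" using z fwd e by (simp add: ray_iff)
    then have "dist q p \<le> dist q z" using p by (simp add: closest_on_def)
    then show ?thesis using dist[OF z] dist[OF pS p0] e by (simp add: divide_le_cancel)
  qed
  have "e \<bullet> (p - q) \<le> e \<bullet> (x - q)" "e \<bullet> (p - q) \<le> e \<bullet> (y - q)"
    using far x y cr by auto
  then have "(1 - t) * (e \<bullet> (x - q) - e \<bullet> (p - q)) + t * (e \<bullet> (y - q) - e \<bullet> (p - q)) = 0"
    "0 \<le> e \<bullet> (x - q) - e \<bullet> (p - q)" "0 \<le> e \<bullet> (y - q) - e \<bullet> (p - q)"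
    using lin(2) by (auto simp: algebra_simps)
  then have "e \<bullet> (x - q) - e \<bullet> (p - q) = 0" "e \<bullet> (y - q) - e \<bullet> (p - q) = 0"
    using t by (smt (verit) mult_pos_pos mult_nonneg_nonneg)+
  then have "e \<bullet> (x - y) = 0" "cross2 e (x - y) = 0"
    using cr by (simp_all add: inner_diff_right cross2_alt algebra_simps)
  then show False using frame_eq_0[OF e] \<open>x \<noteq> y\<close> by fastforce
qed

text \<open>The outcome of a right-angled probe along the line \<open>L\<close>, with the apex
  eliminated: as \<open>p1\<close> lies on the first ray and \<open>p2\<close> on the second one, the coordinates of
  \<open>y\<close> in the frame of the wedge are \<open>d \<bullet> (y - p2)\<close> and \<open>cross2 d (y - p1)\<close>.\<close>
definition contacts :: "complex set \<Rightarrow> dline \<Rightarrow> complex \<Rightarrow> complex \<Rightarrow> complex \<Rightarrow> bool" where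
  "contacts X L d p1 p2 \<longleftrightarrow> d \<noteq> 0 \<and> p1 \<in> X \<and> p2 \<in> X \<and>
     (\<forall>y\<in>X. 0 \<le> d \<bullet> (y - p2) \<and> 0 \<le> cross2 d (y - p1) \<and>
        (d \<bullet> (y - p2) \<noteq> 0 \<or> cross2 d (y - p1) \<noteq> 0)) \<and>
     (\<exists>s>0. d \<bullet> (fst L - p2) = s * (d \<bullet> snd L) \<and> cross2 d (fst L - p1) = s * cross2 d (snd L))"

text \<open>For \<open>u\<close> and \<open>w\<close> in \<open>V\<close>: with \<open>V = X\<close>
  these are the directed edges of the polygon in counterclockwise order; with \<open>V\<close> the
  known vertices they are the edges of the hull of \<open>V\<close>, joining consecutive known
  vertices.\<close>

definition left_of_all :: "complex set \<Rightarrow> complex \<Rightarrow> complex \<Rightarrow> bool" where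
  "left_of_all V u w \<longleftrightarrow> u \<noteq> w \<and> (\<forall>y\<in>V. 0 \<le> cross2 (w - u) (y - u))"

text \<open>Properties of the vertex set that avoid indices: \<open>strict_support\<close> is strict
  convexity, \<open>no_right_wedge\<close> is what the angle bound yields, and
  \<open>successor_closed\<close> says that following the edges from any vertex reaches all others,
  the criterion for having seen everything.\<close>

locale wide_polygon =
  fixes X :: "complex set"
  assumes finite: "finite X"
    and card_ge_3: "card X \<ge> 3"
    and strict_support: "x \<in> X \<Longrightarrow> \<exists>e. \<forall>y\<in>X. y \<noteq> x \<longrightarrow> e \<bullet> (y - x) > 0"
    and no_right_wedge: "x \<in> X \<Longrightarrow> d \<noteq> 0 \<Longrightarrow> \<exists>y\<in>X. d \<bullet> (y - x) < 0 \<or> cross2 d (y - x) < 0"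
    and successor_closed: "V \<subseteq> X \<Longrightarrow> V \<noteq> {} \<Longrightarrow> (\<forall>u\<in>V. \<exists>w\<in>V. left_of_all X u w) \<Longrightarrow> V = X"
begin

text \<open>\<open>r\<close> is the position of \<open>c\<close> on the common line with
  \<open>a\<close> at 0 and \<open>b\<close> at 1. The supports at \<open>a\<close> and
  \<open>b\<close> force \<open>c\<close> strictly between them, where a strict support at
  \<open>c\<close> is impossible.\<close>

lemma not_collinear:
  assumes "a \<in> X" "b \<in> X" "c \<in> X" "a \<noteq> b" "a \<noteq> c" "b \<noteq> c"
  shows "cross2 (b - a) (c - a) \<noteq> 0"
proof
  assume 0: "cross2 (b - a) (c - a) = 0"
  define r where "r = (b - a) \<bullet> (c - a) / (norm (b - a))\<^sup>2"
  have "c - a = of_real r * (b - a)"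
    using frame_expansion[of "b - a" "c - a"] assms 0 by (simp add: r_def)
  then have c: "c = a + r *\<^sub>R (b - a)" by (simp add: scaleR_conv_of_real algebra_simps)
  obtain e where "e \<bullet> (b - a) > 0" "e \<bullet> (c - a) > 0" using strict_support[of a] assms by metis
  then have r0: "r > 0" by (simp add: c zero_less_mult_iff)
  obtain e where "e \<bullet> (a - b) > 0" "e \<bullet> (c - b) > 0" using strict_support[of b] assms by metis
  moreover have "e \<bullet> (c - b) = (1 - r) * (e \<bullet> (a - b))"
    by (simp add: c inner_diff_right inner_add_right algebra_simps)
  ultimately have r1: "r < 1" by (simp add: zero_less_mult_iff)
  obtain e where "e \<bullet> (a - c) > 0" "e \<bullet> (b - c) > 0" using strict_support[of c] assms by metis
  moreover have "e \<bullet> (a - c) = - r * (e \<bullet> (b - a))" "e \<bullet> (b - c) = (1 - r) * (e \<bullet> (b - a))"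
    by (simp_all add: c inner_diff_right inner_add_right algebra_simps)
  ultimately show False using r0 r1 by (simp add: zero_less_mult_iff mult_less_0_iff)
qed

text \<open>Two candidates would each lie weakly left of the edge to the other, hence be collinear
  with \<open>u\<close>.\<close>

lemma successor_unique:
  assumes "u \<in> X" "w \<in> X" "w' \<in> X" "left_of_all X u w" "left_of_all X u w'"
  shows "w = w'"
proof (rule ccontr)
  assume "w \<noteq> w'"
  then have "cross2 (w - u) (w' - u) \<noteq> 0"
    using not_collinear[of u w w'] assms by (auto simp: left_of_all_def)
  moreover have "cross2 (w - u) (w' - u) \<ge> 0" "cross2 (w' - u) (w - u) \<ge> 0"
    using assms by (auto simp: left_of_all_def)
  ultimately show False by (simp add: cross2_alt mult.commute)
qed

text \<open>On the wedge the sum \<open>g\<close> of the two coordinates is least at the apex alone,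
  so an apex in the hull would be a vertex, against \<open>no_right_wedge\<close>.\<close>

lemma apex_outside:
  assumes "d \<noteq> 0" "convex hull X \<subseteq> wedge (pi/2) q d"
  shows "q \<notin> convex hull X"
proof
  assume q: "q \<in> convex hull X"
  have XX: "X \<subseteq> convex hull X" by (rule hull_subset)
  have W: "0 \<le> d \<bullet> (y - q)" "0 \<le> cross2 d (y - q)" if "y \<in> X" for y
    using assms that XX by (auto simp: wedge_iff subset_iff)
  define g where "g = d + \<i> * d"
  have g: "g \<bullet> w = d \<bullet> w + cross2 d w" for w
    by (simp add: g_def inner_add_left cross2_ii)
  have "\<exists>y\<in>X. g \<bullet> y \<le> g \<bullet> q"
  proof (rule ccontr)
    assume "\<not> ?thesis"
    then have gt: "g \<bullet> q < g \<bullet> y" if "y \<in> X" for y using that by force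
    have ne: "X \<noteq> {}" using card_ge_3 by auto
    have "Min ((\<bullet>) g ` X) \<le> g \<bullet> q"
      by (rule inner_ge_on_hull[OF _ q]) (use finite in auto)
    moreover have "g \<bullet> q < Min ((\<bullet>) g ` X)" using gt finite ne by simp
    ultimately show False by simp
  qed
  then obtain y where y: "y \<in> X" "g \<bullet> y \<le> g \<bullet> q" by blast
  then have "d \<bullet> (y - q) + cross2 d (y - q) \<le> 0" using g[of "y - q"] by (simp add: inner_diff_right)
  then have "y = q" using W[OF y(1)] frame_eq_0[OF assms(1), of "y - q"] by fastforce
  then show False using no_right_wedge[OF y(1) assms(1)] W by force
qed

text \<open>Turns a response into vertices and inequalities free of the apex. The last conjunct lets
  flushness with the second ray be read off the returned ray.\<close>

lemma response_contacts:
  assumes x: "x \<in> convex hull X" and v: "v \<noteq> 0"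
    and r: "valid_response (pi/2) (convex hull X) (x, v) r"
  shows "\<exists>q H1 d p1 p2. r = Hit q H1 (ray q (\<i> * d)) p1 p2 \<and> contacts X (x, v) d p1 p2 \<and>
           (\<forall>y\<in>X. y \<in> ray q (\<i> * d) \<longleftrightarrow> d \<bullet> (y - p2) = 0)"
proof -
  have "r \<noteq> Miss" using r valid_probe_exists[OF finite x v] by (auto simp: valid_response_def)
  then obtain q H1 H2 p1 p2 where rr: "r = Hit q H1 H2 p1 p2" by (cases r) auto
  with r obtain d where vp: "valid_probe (pi/2) (convex hull X) (x, v) q d"
    and H: "H1 = ray q d" "H2 = ray q (\<i> * d)"
    and cl: "closest_on (convex hull X \<inter> ray q d) q p1" "closest_on (convex hull X \<inter> ray q (\<i> * d)) q p2"
    by (auto simp: valid_response_def)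
  have d: "d \<noteq> 0" and sub: "convex hull X \<subseteq> wedge (pi/2) q d" using vp by (auto simp: valid_probe_def)
  have id: "\<i> * d \<noteq> 0" using d by simp
  have qn: "q \<notin> convex hull X" using apex_outside[OF d sub] .
  have XX: "X \<subseteq> convex hull X" by (rule hull_subset)
  have W: "0 \<le> d \<bullet> (y - q)" "0 \<le> cross2 d (y - q)" if "y \<in> convex hull X" for y
    using d sub that by (auto simp: wedge_iff subset_iff)
  have "p1 extreme_point_of (convex hull X)"
    by (rule closest_on_ray_extreme[OF d _ _ cl(1)]) (use W in auto)
  then have p1: "p1 \<in> X" by (rule extreme_point_of_convex_hull)
  have "p2 extreme_point_of (convex hull X)"
    by (rule closest_on_ray_extreme[OF id _ _ cl(2)]) (use W in \<open>auto simp: cross2_ii\<close>)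
  then have p2: "p2 \<in> X" by (rule extreme_point_of_convex_hull)
  have c1: "cross2 d (p1 - q) = 0" using cl(1) d by (simp add: closest_on_def ray_iff)
  have c2: "d \<bullet> (p2 - q) = 0" using cl(2) d by (simp add: closest_on_def ray_ii_iff)
  have e1: "cross2 d (y - p1) = cross2 d (y - q)" for y
    using c1 by (simp add: cross2_alt algebra_simps)
  have e2: "d \<bullet> (y - p2) = d \<bullet> (y - q)" for y
    using c2 by (simp add: inner_diff_right)
  have nz: "d \<bullet> (y - q) \<noteq> 0 \<or> cross2 d (y - q) \<noteq> 0" if "y \<in> convex hull X" for y
    using frame_eq_0[OF d, of "y - q"] that qn by auto
  obtain s where s: "s \<ge> 0" "q + of_real s * v \<in> convex hull X"
    using vp by (auto simp: valid_probe_def ray_def)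
  have sp: "s > 0" using s qn by (cases "s = 0") auto
  have "0 \<le> s * (d \<bullet> v)" "0 \<le> s * cross2 d v"
    using W[OF s(2)] by (simp_all add: cross2_alt inner_complex_def algebra_simps)
  then have v0: "0 \<le> d \<bullet> v" "0 \<le> cross2 d v" using sp by (simp_all add: zero_le_mult_iff)
  have v1: "0 < d \<bullet> v \<or> 0 < cross2 d v" using v0 frame_eq_0[OF d, of v] v by fastforce
  \<comment> \<open>The apex lies strictly behind \<open>x\<close>: in the frame \<open>v\<close>
    has nonnegative coordinates, not both zero, so \<open>x\<close> in the wedge forces
    \<open>t \<le> 0\<close>, and \<open>t = 0\<close> would put the apex into the hull. The factor
    demanded by \<open>contacts\<close> is \<open>- t\<close>.\<close>
  obtain t where t: "q = x + of_real t * v" using vp by (auto simp: valid_probe_def on_line_def)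
  have xt: "d \<bullet> (x - q) = (- t) * (d \<bullet> v)" "cross2 d (x - q) = (- t) * cross2 d v"
    by (simp_all add: t cross2_alt inner_complex_def algebra_simps)
  have "- t \<ge> 0" using W[OF x] v0 v1 unfolding xt by (auto simp: zero_le_mult_iff mult_le_0_iff)
  moreover have "t \<noteq> 0" using x qn t by auto
  ultimately have "- t > 0" by simp
  then have "contacts X (x, v) d p1 p2"
    unfolding contacts_def e1 e2 fst_conv snd_conv using d p1 p2 W XX nz xt by blast
  moreover have "\<forall>y\<in>X. y \<in> ray q (\<i> * d) \<longleftrightarrow> d \<bullet> (y - p2) = 0"
    using W XX d by (auto simp: ray_ii_iff e2 subset_iff)
  ultimately show ?thesis using rr H by blast
qed

end

section \<open>Probes along chords\<close>

lemma frame_identities: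
  "(norm d)\<^sup>2 * cross2 a b = (d \<bullet> a) * cross2 d b - cross2 d a * (d \<bullet> b)"
  "(norm d)\<^sup>2 * (a \<bullet> b) = (d \<bullet> a) * (d \<bullet> b) + cross2 d a * cross2 d b"
  unfolding cmod_power2 by (simp_all add: cross2_alt inner_complex_def power2_eq_square algebra_simps)

text \<open>Cramer's rule \<open>cross2 a b * c = cross2 c b * a + cross2 a c * b\<close> with
  \<open>cross2 d\<close> applied to it.\<close>

lemma cross2_pluecker:
  "cross2 a b * cross2 d c = cross2 a c * cross2 d b + cross2 c b * cross2 d a"
  by (simp add: cross2_alt algebra_simps)

lemma cross2_rotate: "cross2 (b - a) (c - a) = cross2 (c - b) (a - b)"
  by (simp add: cross2_alt algebra_simps)

lemma cross2_diff: "cross2 d (a - b) = cross2 d a - cross2 d b"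
  by (simp add: cross2_alt algebra_simps)

lemma contactsD:
  assumes "contacts X L d p1 p2"
  shows "d \<noteq> 0" "p1 \<in> X" "p2 \<in> X"
    and "\<And>y. y \<in> X \<Longrightarrow> 0 \<le> d \<bullet> (y - p2)" "\<And>y. y \<in> X \<Longrightarrow> 0 \<le> cross2 d (y - p1)"
    and "\<And>y. y \<in> X \<Longrightarrow> d \<bullet> (y - p2) = 0 \<Longrightarrow> cross2 d (y - p1) \<noteq> 0"
  using assms unfolding contacts_def by blast+

lemma contacts_distinct:
  assumes "contacts X L d p1 p2"
  shows "0 < d \<bullet> (p1 - p2)" "0 < cross2 d (p2 - p1)" "p1 \<noteq> p2"
proof -
  note c = contactsD[OF assms]
  show 1: "0 < d \<bullet> (p1 - p2)"
    using c(6)[OF c(2)] c(4)[OF c(2)] by (force simp: cross2_def)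
  show "0 < cross2 d (p2 - p1)"
    using c(6)[OF c(3)] c(5)[OF c(3)] by force
  show "p1 \<noteq> p2" using 1 by auto
qed

text \<open>The apex lies on the line behind \<open>w\<close>, so the line runs through the wedge
  between its rays: the second contact is to its left and the first to its right, unless the
  respective ray lies along it. \<open>d \<bullet> (u - w) = 0\<close> expresses that the second ray
  is flush, \<open>cross2 d (u - w) = 0\<close> that the first one is.\<close>

lemma chord_probe:
  assumes c: "contacts X (w, u - w) d p1 p2" and w: "w \<in> X" and u: "u \<in> X" and ne: "u \<noteq> w"
  shows "0 \<le> d \<bullet> (u - w)" "0 \<le> cross2 d (u - w)"
    and "d \<bullet> (u - p2) = 0 \<longleftrightarrow> d \<bullet> (u - w) = 0"
    and "d \<bullet> (w - p2) = 0 \<longleftrightarrow> d \<bullet> (u - w) = 0"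
    and "cross2 d (w - p1) = 0 \<longleftrightarrow> cross2 d (u - w) = 0"
    and "0 < d \<bullet> (u - w) \<Longrightarrow> 0 < cross2 (u - w) (p2 - w)"
    and "d \<bullet> (u - w) = 0 \<Longrightarrow> cross2 (u - w) (p2 - w) = 0"
    and "0 < cross2 d (u - w) \<Longrightarrow> cross2 (u - w) (p1 - w) < 0"
proof -
  note cd = contactsD[OF c] and dis = contacts_distinct[OF c]
  obtain s where s: "s > 0" "d \<bullet> (w - p2) = s * (d \<bullet> (u - w))" "cross2 d (w - p1) = s * cross2 d (u - w)"
    using c unfolding contacts_def by auto
  show 1: "0 \<le> d \<bullet> (u - w)" "0 \<le> cross2 d (u - w)"
    using cd(4,5)[OF w] s by (auto simp: zero_le_mult_iff)
  have "d \<bullet> (u - p2) = (s + 1) * (d \<bullet> (u - w))"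
    using s(2) by (simp add: inner_diff_right algebra_simps)
  then show "d \<bullet> (u - p2) = 0 \<longleftrightarrow> d \<bullet> (u - w) = 0" using s(1) by simp
  show "d \<bullet> (w - p2) = 0 \<longleftrightarrow> d \<bullet> (u - w) = 0" "cross2 d (w - p1) = 0 \<longleftrightarrow> cross2 d (u - w) = 0"
    using s by auto
  have K: "(norm d)\<^sup>2 > 0" using cd(1) by simp
  have E: "cross2 d (p2 - w) = cross2 d (p2 - p1) - s * cross2 d (u - w)" "d \<bullet> (p2 - w) = - s * (d \<bullet> (u - w))"
    "d \<bullet> (p1 - w) = d \<bullet> (p1 - p2) - s * (d \<bullet> (u - w))" "cross2 d (p1 - w) = - s * cross2 d (u - w)"
    using s(2,3) by (simp_all add: cross2_diff inner_diff_right)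
  \<comment> \<open>As the apex is on the line, each cross product is that of the line direction
    with a vector along one ray, which has a zero coordinate in the frame.\<close>
  have e: "(norm d)\<^sup>2 * cross2 (u - w) (p2 - w) = (d \<bullet> (u - w)) * cross2 d (p2 - p1)"
    "(norm d)\<^sup>2 * cross2 (u - w) (p1 - w) = - (cross2 d (u - w) * (d \<bullet> (p1 - p2)))"
    unfolding frame_identities(1)[of d] E by (simp_all add: left_diff_distrib right_diff_distrib mult_ac)
  show "0 < cross2 (u - w) (p2 - w)" if "0 < d \<bullet> (u - w)"
    using e(1) K that dis by (metis mult_pos_pos zero_less_mult_pos)
  show "cross2 (u - w) (p2 - w) = 0" if "d \<bullet> (u - w) = 0"
    using e(1) K that by simp
  show "cross2 (u - w) (p1 - w) < 0" if "0 < cross2 d (u - w)"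
  proof -
    have "(norm d)\<^sup>2 * cross2 (u - w) (p1 - w) < 0" using e(2) that dis by simp
    then show ?thesis using K by (simp add: mult_less_0_iff)
  qed
qed

text \<open>In the next three lemmas all coordinates refer to the frame of the first probe, whose contacts
  are \<open>A = (s, 0)\<close> and \<open>B = (0, t)\<close>: \<open>(c, \<sigma>)\<close> is the direction of the second probe,
  \<open>v\<close> the direction of a later probe from \<open>C\<close>, \<open>w = A - C\<close>, and \<open>(c', \<sigma>')\<close> the direction of the
  first ray of that later probe.\<close>
lemma second_direction_quadrant:
  fixes c \<sigma> s t x y :: real
  assumes "s > 0" "t > 0" "- s * c + t * \<sigma> \<ge> 0" "c * t + \<sigma> * s > 0" "y \<ge> 0"
    and "t * (s - x) \<ge> s * y" "- s * c + t * \<sigma> = 0 \<or> c * x + \<sigma> * y < c * s"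
  shows "c > 0" "\<sigma> > 0"
proof -
  \<comment> \<open>The second direction is turned clockwise from \<open>B - A = (-s, t)\<close> by
    at most a right angle, which keeps it in the open upper half-plane.\<close>
  show sg: "\<sigma> > 0"
  proof (rule ccontr)
    assume n: "\<not> \<sigma> > 0"
    then have "t * \<sigma> \<le> 0" "\<sigma> * s \<le> 0" using assms(1,2) by (simp_all add: mult_le_0_iff)
    with assms(3,4) have "s * c \<le> 0" "c * t > 0" by linarith+
    then show False using assms(1,2) by (simp add: mult_le_0_iff zero_less_mult_iff)
  qed
  \<comment> \<open>If \<open>c \<le> 0\<close>, the second ray is not flush and its contact
    \<open>(x, y)\<close> comes strictly before \<open>A\<close> in the second direction. This needs
    \<open>x > s\<close>, while a point not below the first axis and left of the line from
    \<open>A\<close> to \<open>B\<close> has \<open>x \<le> s\<close>.\<close>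
  show "c > 0"
  proof (rule ccontr)
    assume n: "\<not> c > 0"
    have "s * c \<le> 0" "t * \<sigma> > 0" using n sg assms(1,2) by (simp_all add: mult_le_0_iff)
    then have "c * x + \<sigma> * y < c * s" using assms(7) by linarith
    moreover have "\<sigma> * y \<ge> 0" using sg assms(5) by simp
    ultimately have "c * (s - x) > 0" by (simp add: algebra_simps)
    then have "s - x < 0" using n by (auto simp: zero_less_mult_iff)
    moreover have "s * y \<ge> 0" using assms by simp
    then have "t * (s - x) \<ge> 0" using assms(6) by linarith
    ultimately show False using assms(2) by (simp add: zero_le_mult_iff)
  qed
qed

lemma third_quadrant:
  fixes c \<sigma> vx vy wx wy :: real
  assumes "c > 0" "\<sigma> > 0" "wy \<le> 0" "c * wy - \<sigma> * wx > 0"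
    and "c * vy - \<sigma> * vx \<ge> 0" "wx * vy - wy * vx \<ge> 0" "vx \<noteq> 0 \<or> vy \<noteq> 0"
  shows "vx < 0" "vy \<le> 0" "wx < 0"
proof -
  have "c * wy \<le> 0" using assms by (simp add: mult_le_0_iff)
  then have "\<sigma> * wx < 0" using assms by linarith
  then show wx: "wx < 0" using assms by (simp add: mult_less_0_iff)
  define hw hv k where "hw = c * wy - \<sigma> * wx" and "hv = c * vy - \<sigma> * vx" and "k = wx * vy - wy * vx"
  have pos: "hw > 0" "hv \<ge> 0" "k \<ge> 0" using assms by (simp_all add: hw_def hv_def k_def)
  \<comment> \<open>Cramer's rule puts \<open>v\<close> into the cone of \<open>w\<close> and the
    opposite of \<open>(c, \<sigma>)\<close>, both of which point into the third quadrant.\<close>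
  have e: "hw * vx = hv * wx - k * c" "hw * vy = hv * wy - k * \<sigma>"
    by (simp_all add: hw_def hv_def k_def algebra_simps)
  have n: "hv * wx \<le> 0" "k * c \<ge> 0" "hv * wy \<le> 0" "k * \<sigma> \<ge> 0"
    using pos wx assms by (simp_all add: mult_le_0_iff)
  have x: "vx \<le> 0" using e n pos by (smt (verit) mult_pos_pos)
  show "vy \<le> 0" using e n pos by (smt (verit) mult_pos_pos)
  have "vx \<noteq> 0"
  proof
    assume "vx = 0"
    then have "hv * wx = 0" "k * c = 0" using e(1) n by auto
    then have "hv = 0" "k = 0" using wx assms(1) by auto
    then have "hw * vy = 0" using e(2) by simp
    then show False using pos \<open>vx = 0\<close> assms(7) by simp
  qed
  with x show "vx < 0" by simp
qed

lemma probe_direction_quadrant: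
  fixes c \<sigma> c' \<sigma>' vx vy yx yy :: real
  assumes "c > 0" "\<sigma> > 0" "vx < 0" "vy \<le> 0"
    and a: "c' * vx + \<sigma>' * vy \<ge> 0" and b: "c' * vy - \<sigma>' * vx > 0"
    and alt: "c' * vx + \<sigma>' * vy = 0 \<or>
      vx * yy - vy * yx > 0 \<and> c * yy - \<sigma> * yx \<ge> 0 \<and> c' * yx + \<sigma>' * yy \<le> 0 \<and> c * vy - \<sigma> * vx \<ge> 0"
  shows "c' \<le> 0" "\<sigma>' > 0"
proof -
  show c': "c' \<le> 0"
  proof (rule ccontr)
    assume n: "\<not> c' \<le> 0"
    then have "c' * vx < 0" "c' * vy \<le> 0" using assms by (simp_all add: mult_less_0_iff mult_le_0_iff)
    then have "\<sigma>' * vy > 0" "\<sigma>' * vx < 0" using a b by linarith+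
    then show False using assms by (simp add: mult_less_0_iff zero_less_mult_iff)
  qed
  show "\<sigma>' > 0"
  proof (rule ccontr)
    assume n: "\<not> \<sigma>' > 0"
    have p: "c' * vx \<ge> 0" "\<sigma>' * vy \<ge> 0" using n c' assms by (simp_all add: zero_le_mult_iff)
    from alt show False
    proof
      assume "c' * vx + \<sigma>' * vy = 0"
      then have "c' * vx = 0" using p by linarith
      then have "c' = 0" using assms by simp
      then have "\<sigma>' * vx < 0" using b by simp
      then show False using n assms by (simp add: mult_less_0_iff)
    next
      assume y: "vx * yy - vy * yx > 0 \<and> c * yy - \<sigma> * yx \<ge> 0 \<and> c' * yx + \<sigma>' * yy \<le> 0 \<and> c * vy - \<sigma> * vx \<ge> 0"
      \<comment> \<open>\<open>(yx, yy)\<close> lies in the cone of \<open>v\<close> and the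
        opposite of \<open>(c, \<sigma>)\<close>. The identity evaluates the inner product with
        \<open>(c', \<sigma>')\<close> on that cone; \<open>\<sigma>' \<le> 0\<close> would make the
        right-hand side positive and leave the left-hand side nonpositive.\<close>
      have "(c * vy - \<sigma> * vx) * (c' * yx + \<sigma>' * yy) =
        (c * yy - \<sigma> * yx) * (c' * vx + \<sigma>' * vy) + (vx * yy - vy * yx) * (- (c' * c) - \<sigma>' * \<sigma>)"
        by (simp add: algebra_simps)
      moreover have "(c * vy - \<sigma> * vx) * (c' * yx + \<sigma>' * yy) \<le> 0" "(c * yy - \<sigma> * yx) * (c' * vx + \<sigma>' * vy) \<ge> 0"
        using y a by (simp_all add: mult_le_0_iff)
      moreover have "c' \<noteq> 0 \<or> \<sigma>' \<noteq> 0" using b by auto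
      then have "- (c' * c) - \<sigma>' * \<sigma> > 0"
        using n c' assms(1,2) by (smt (verit) mult_neg_pos mult_nonpos_nonneg)
      then have "(vx * yy - vy * yx) * (- (c' * c) - \<sigma>' * \<sigma>) > 0" using y by simp
      ultimately show False by linarith
    qed
  qed
qed

section \<open>The pivot\<close>

text \<open>In the frame of the first probe (direction \<open>d1\<close>, contacts \<open>A\<close>, \<open>B\<close>) the direction \<open>d2\<close> of
  the second one lies in the open first quadrant, and its first contact \<open>C\<close> lies strictly beyond
  the line from \<open>A\<close> to \<open>B\<close>.\<close>
definition pivot_data :: "complex set \<Rightarrow> complex \<Rightarrow> complex \<Rightarrow> complex \<Rightarrow> complex \<Rightarrow> complex \<Rightarrow> bool" where
  "pivot_data X d1 A B d2 C \<longleftrightarrow> d1 \<noteq> 0 \<and> {A, B, C} \<subseteq> X \<and>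
     (\<forall>y\<in>X. 0 \<le> d1 \<bullet> (y - B) \<and> 0 \<le> cross2 d1 (y - A) \<and> 0 \<le> cross2 d2 (y - C)) \<and>
     0 < d1 \<bullet> (A - B) \<and> 0 < cross2 d1 (B - A) \<and>
     0 < d1 \<bullet> d2 \<and> 0 < cross2 d1 d2 \<and> 0 < cross2 d2 (A - C) \<and> cross2 (B - A) (C - A) < 0"

context wide_polygon
begin

text \<open>The first ray cannot be flush with the line from \<open>A\<close> to \<open>B\<close>,
  so \<open>C\<close> lies strictly beyond it, and frame coordinates give the quadrant of
  \<open>d2\<close>. The second conclusion starts the invariant that all seen vertices lie left of
  the line from \<open>C\<close> to \<open>B\<close>.\<close>

lemma second_probe:
  assumes c1: "contacts X L d1 A B" and c2: "contacts X (A, B - A) d2 C D"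
  shows "pivot_data X d1 A B d2 C" "0 \<le> cross2 (B - C) (D - C)"
proof -
  note k1 = contactsD[OF c1] and k2 = contactsD[OF c2]
  note dis1 = contacts_distinct[OF c1]
  have ne: "B \<noteq> A" using dis1(3) by simp
  note ch = chord_probe[OF c2 k1(2,3) ne]
  define s t K c \<sigma> x y where "s = d1 \<bullet> (A - B)" and "t = cross2 d1 (B - A)" and "K = (norm d1)\<^sup>2"
    and "c = d1 \<bullet> d2" and "\<sigma> = cross2 d1 d2" and "x = d1 \<bullet> (D - B)" and "y = cross2 d1 (D - A)"
  have st: "s > 0" "t > 0" using dis1 by (simp_all add: s_def t_def)
  have K: "K > 0" using k1(1) by (simp add: K_def)
  have Xv: "d1 \<bullet> (B - A) = - s" by (simp add: s_def inner_diff_right)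
  have av: "K * (d2 \<bullet> (B - A)) = - s * c + t * \<sigma>"
    unfolding K_def frame_identities(2) Xv by (simp add: c_def \<sigma>_def t_def)
  have bv: "K * cross2 d2 (B - A) = c * t + \<sigma> * s"
    unfolding K_def frame_identities(1) Xv by (simp add: c_def \<sigma>_def t_def)
  \<comment> \<open>A flush first ray would confine the polygon to the triangle of \<open>A\<close>,
    \<open>B\<close> and the first apex, which lies in the right-angled wedge at \<open>A\<close>
    with first direction \<open>\<i> * d1\<close>.\<close>
  have bpos: "0 < cross2 d2 (B - A)"
  proof (rule ccontr)
    assume "\<not> ?thesis"
    with ch(2) have b0: "cross2 d2 (B - A) = 0" by simp
    have "B - A \<noteq> 0" using ne by simp
    then have a0: "d2 \<bullet> (B - A) > 0" using ch(1) frame_eq_0[OF k2(1) _ b0] by fastforce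
    have cA: "cross2 d2 (A - C) = 0" using ch(5) b0 by simp
    have left: "0 \<le> cross2 (B - A) (z - A)" if "z \<in> X" for z
    proof -
      have "0 \<le> cross2 d2 (z - A)" using k2(5)[OF that] cA by (simp add: cross2_diff)
      then have "0 \<le> (norm d2)\<^sup>2 * cross2 (B - A) (z - A)"
        unfolding frame_identities(1) b0 using a0 by simp
      then show ?thesis using k2(1) by (simp add: zero_le_mult_iff)
    qed
    have "\<exists>z\<in>X. (\<i> * d1) \<bullet> (z - A) < 0 \<or> cross2 (\<i> * d1) (z - A) < 0"
      using no_right_wedge[OF k1(2), of "\<i> * d1"] k1(1) by simp
    then obtain z where z: "z \<in> X" "cross2 d1 (z - A) < 0 \<or> d1 \<bullet> (z - A) > 0"
      by (auto simp: cross2_ii)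
    have Y: "cross2 d1 (z - A) \<ge> 0" using k1(5) z by simp
    have "0 \<le> K * cross2 (B - A) (z - A)" using left[OF z(1)] K by simp
    then have "0 \<le> - s * cross2 d1 (z - A) - t * (d1 \<bullet> (z - A))"
      unfolding K_def frame_identities(1) Xv by (simp add: t_def)
    moreover have "s * cross2 d1 (z - A) \<ge> 0" using st Y by simp
    moreover have "t * (d1 \<bullet> (z - A)) > 0" using st z Y by simp
    ultimately show False by simp
  qed
  have Dl: "0 \<le> cross2 (B - A) (D - A)" using ch(1,6,7) by (cases "d2 \<bullet> (B - A) = 0") force+
  have XDA: "d1 \<bullet> (D - A) = x - s" by (simp add: x_def s_def inner_diff_right)
  have Dl': "K * cross2 (B - A) (D - A) = t * (s - x) - s * y"
    unfolding K_def frame_identities(1) Xv XDA by (simp add: t_def y_def algebra_simps)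
  have xy: "x \<ge> 0" "y \<ge> 0" using k1(4,5) k2(3) by (simp_all add: x_def y_def)
  have alt: "- s * c + t * \<sigma> = 0 \<or> c * x + \<sigma> * y < c * s"
  proof (cases "d2 \<bullet> (B - A) = 0")
    case True
    then show ?thesis using av by simp
  next
    case False
    then have "d2 \<bullet> (A - D) > 0" using ch(4) k2(4)[OF k1(2)] by simp
    then have "K * (d2 \<bullet> (D - A)) < 0" using K by (simp add: inner_diff_right mult_pos_neg)
    then have "c * (x - s) + \<sigma> * y < 0"
      unfolding K_def frame_identities(2) XDA by (simp add: c_def \<sigma>_def y_def)
    then show ?thesis by (simp add: algebra_simps)
  qed
  have p1: "- s * c + t * \<sigma> \<ge> 0" using av K ch(1) by (metis mult_nonneg_nonneg less_imp_le)
  have p2: "c * t + \<sigma> * s > 0" using bv K bpos by (metis mult_pos_pos)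
  have "K * cross2 (B - A) (D - A) \<ge> 0" using K Dl by simp
  then have p3: "t * (s - x) \<ge> s * y" using Dl' by simp
  have cs: "c > 0" "\<sigma> > 0"
    using second_direction_quadrant[OF st p1 p2 xy(2) p3 alt] by auto
  have C0: "cross2 (B - A) (C - A) < 0" using ch(8) bpos by simp
  have A0: "cross2 d2 (A - C) > 0" using ch(5) bpos k2(5)[OF k1(2)] by simp
  show "pivot_data X d1 A B d2 C"
    unfolding pivot_data_def using k1 k2 st cs C0 A0
    by (auto simp: s_def t_def c_def \<sigma>_def)
  define p where "p = d1 \<bullet> (C - B)"
  have p0: "p \<ge> 0" using k1(4) k2(2) by (simp add: p_def)
  have AB: "cross2 (B - C) (A - B) > 0" using C0 by (simp add: cross2_alt algebra_simps)
  have e1: "K * cross2 (B - C) (D - B) = - p * (y - t) - cross2 d1 (B - C) * x"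
  proof -
    have "d1 \<bullet> (B - C) = - p" "cross2 d1 (D - B) = y - t" "d1 \<bullet> (D - B) = x"
      by (simp_all add: p_def y_def t_def x_def inner_diff_right cross2_diff)
    then show ?thesis unfolding K_def frame_identities(1) by simp
  qed
  have e2: "K * cross2 (B - C) (A - B) = p * t - cross2 d1 (B - C) * s"
  proof -
    have "d1 \<bullet> (B - C) = - p" "cross2 d1 (A - B) = - t" "d1 \<bullet> (A - B) = s"
      by (simp_all add: p_def s_def t_def inner_diff_right cross2_diff)
    then show ?thesis unfolding K_def frame_identities(1) by simp
  qed
  \<comment> \<open>\<open>D - B\<close> splits into nonnegative multiples of \<open>A - B\<close>
    and of the reversed second axis, both of which point weakly left of the line from
    \<open>C\<close> to \<open>B\<close>.\<close>
  have "s * (K * cross2 (B - C) (D - B)) = p * (t * (s - x) - s * y) + x * (K * cross2 (B - C) (A - B))"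
    unfolding e1 e2 by (simp add: algebra_simps)
  moreover have "p * (t * (s - x) - s * y) \<ge> 0" "x * (K * cross2 (B - C) (A - B)) \<ge> 0"
    using p0 p3 xy K AB by simp_all
  ultimately have "0 \<le> s * (K * cross2 (B - C) (D - B))" by simp
  then have "0 \<le> cross2 (B - C) (D - B)" using st K by (simp add: zero_le_mult_iff)
  then show "0 \<le> cross2 (B - C) (D - C)" by (simp add: cross2_alt algebra_simps)
qed

text \<open>Seen from \<open>C\<close>, all of \<open>V\<close> lies in the cone from
  \<open>B - C\<close> to \<open>u - C\<close>. The form \<open>cross2 d\<close> is least at the
  first contact; once it is positive on both sides of the cone, no point of \<open>V\<close> other
  than \<open>C\<close> can be that contact. The angle at \<open>B\<close> rules out the remaining
  case.\<close>

lemma pivot_probe: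
  assumes pd: "pivot_data X d1 A B d2 C"
    and V: "V \<subseteq> X" "A \<in> V" "B \<in> V"
    and left: "\<And>y. y \<in> V \<Longrightarrow> 0 \<le> cross2 (B - C) (y - C)"
    and u: "u \<in> V" "left_of_all V u C"
    and c: "contacts X (C, u - C) d p1 p2"
  shows "p1 \<notin> V \<or> p1 = C \<and> d \<bullet> (u - C) \<noteq> 0 \<and> 0 \<le> cross2 (B - C) (p2 - C)"
proof -
  have d1: "d1 \<noteq> 0" and ABC: "A \<in> X" "B \<in> X" "C \<in> X"
    and X0: "\<And>y. y \<in> X \<Longrightarrow> 0 \<le> d1 \<bullet> (y - B)" and Y0: "\<And>y. y \<in> X \<Longrightarrow> 0 \<le> cross2 d1 (y - A)"
    and H0: "\<And>y. y \<in> X \<Longrightarrow> 0 \<le> cross2 d2 (y - C)"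
    and s: "0 < d1 \<bullet> (A - B)" and t: "0 < cross2 d1 (B - A)"
    and cs: "0 < d1 \<bullet> d2" "0 < cross2 d1 d2" and AC: "0 < cross2 d2 (A - C)"
    and C0: "cross2 (B - A) (C - A) < 0"
    using pd by (auto simp: pivot_data_def)
  have uX: "u \<in> X" and uC: "u \<noteq> C" and uV: "\<And>y. y \<in> V \<Longrightarrow> 0 \<le> cross2 (C - u) (y - u)"
    using u V by (auto simp: left_of_all_def)
  note k = contactsD[OF c]
  note dis = contacts_distinct[OF c]
  note ch = chord_probe[OF c ABC(3) uX uC]
  define K where "K = (norm d1)\<^sup>2"
  have K: "K > 0" using d1 by (simp add: K_def)
  define v w b where "v = u - C" and "w = A - C" and "b = B - C"
  have v0: "v \<noteq> 0" using uC by (simp add: v_def)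
  have bA: "0 < cross2 b w" using C0 by (simp add: b_def w_def cross2_alt algebra_simps)
  have uB: "u \<noteq> B"
  proof
    assume "u = B"
    then have "0 \<le> cross2 (C - B) (A - B)" using uV V by auto
    then show False using C0 cross2_rotate[of B A C] by simp
  qed
  have "B \<noteq> C" using bA by (auto simp: b_def cross2_def)
  then have "cross2 b v \<noteq> 0"
    using not_collinear[of C B u] ABC uX uC uB by (simp add: b_def v_def)
  then have bv: "0 < cross2 b v" using left[OF u(1)] by (simp add: b_def v_def)
  have wv: "0 \<le> cross2 w v"
    using uV[OF V(2)] by (simp add: w_def v_def cross2_alt algebra_simps)
  have wy: "cross2 d1 w \<le> 0" using Y0[OF ABC(3)] by (simp add: w_def cross2_diff)
  have q: "d1 \<bullet> v < 0" "cross2 d1 v \<le> 0" "d1 \<bullet> w < 0"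
  proof -
    have 1: "(d1 \<bullet> d2) * cross2 d1 w - cross2 d1 d2 * (d1 \<bullet> w) > 0"
      unfolding frame_identities(1)[symmetric] using AC K by (simp add: K_def w_def)
    have 2: "(d1 \<bullet> d2) * cross2 d1 v - cross2 d1 d2 * (d1 \<bullet> v) \<ge> 0"
      unfolding frame_identities(1)[symmetric] using H0[OF uX] K by (simp add: K_def v_def)
    have 3: "(d1 \<bullet> w) * cross2 d1 v - cross2 d1 w * (d1 \<bullet> v) \<ge> 0"
      unfolding frame_identities(1)[symmetric] using wv K by (simp add: K_def)
    have 4: "d1 \<bullet> v \<noteq> 0 \<or> cross2 d1 v \<noteq> 0" using frame_eq_0[OF d1] v0 by blast
    show "d1 \<bullet> v < 0" "cross2 d1 v \<le> 0" "d1 \<bullet> w < 0"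
      using third_quadrant[OF cs wy 1 2 3 4] by auto
  qed
  \<comment> \<open>With the first ray along the line, \<open>B\<close> would lie weakly left of the
    line from \<open>C\<close> to \<open>u\<close>, whereas \<open>u\<close> lies strictly left of
    the one from \<open>C\<close> to \<open>B\<close>.\<close>
  have bpos: "0 < cross2 d v"
  proof (rule ccontr)
    assume "\<not> ?thesis"
    with ch(2) have b0: "cross2 d v = 0" by (simp add: v_def)
    then have a0: "d \<bullet> v > 0" using ch(1) frame_eq_0[OF k(1) _ b0] v0 by (force simp: v_def)
    have "cross2 d (C - p1) = 0" using ch(5) b0 by (simp add: v_def)
    then have f: "0 \<le> cross2 d w" "0 \<le> cross2 d b"
      using k(5)[OF ABC(1)] k(5)[OF ABC(2)] by (simp_all add: w_def b_def cross2_diff)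
    have "(norm d)\<^sup>2 * cross2 b v = - (cross2 d b * (d \<bullet> v))"
      unfolding frame_identities(1) b0 by simp
    moreover have "cross2 d b * (d \<bullet> v) \<ge> 0" using f a0 by simp
    moreover have "(norm d)\<^sup>2 * cross2 b v > 0" using bv k(1) by simp
    ultimately show False by simp
  qed
  define c' \<sigma>' where "c' = d1 \<bullet> d" and "\<sigma>' = cross2 d1 d"
  have new2: "0 < cross2 v (p2 - C)" if "d \<bullet> v \<noteq> 0"
    using ch(1,6) that by (simp add: v_def)
  have q': "c' \<le> 0" "\<sigma>' > 0"
  proof -
    define y where "y = p2 - C"
    have 1: "c' * (d1 \<bullet> v) + \<sigma>' * cross2 d1 v \<ge> 0"
      unfolding c'_def \<sigma>'_def frame_identities(2)[symmetric] using ch(1) by (simp add: v_def)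
    have 2: "c' * cross2 d1 v - \<sigma>' * (d1 \<bullet> v) > 0"
      unfolding c'_def \<sigma>'_def frame_identities(1)[symmetric] using bpos d1 by simp
    have 3: "c' * (d1 \<bullet> v) + \<sigma>' * cross2 d1 v = 0 \<or>
      (d1 \<bullet> v) * cross2 d1 y - cross2 d1 v * (d1 \<bullet> y) > 0 \<and>
      (d1 \<bullet> d2) * cross2 d1 y - cross2 d1 d2 * (d1 \<bullet> y) \<ge> 0 \<and>
      c' * (d1 \<bullet> y) + \<sigma>' * cross2 d1 y \<le> 0 \<and>
      (d1 \<bullet> d2) * cross2 d1 v - cross2 d1 d2 * (d1 \<bullet> v) \<ge> 0"
    proof (cases "d \<bullet> v = 0")
      case True
      then show ?thesis unfolding c'_def \<sigma>'_def frame_identities(2)[symmetric] by simp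
    next
      case False
      have "d \<bullet> y \<le> 0" using k(4)[OF ABC(3)] by (simp add: y_def inner_diff_right)
      then have "(norm d1)\<^sup>2 * (d \<bullet> y) \<le> 0" by (simp add: mult_le_0_iff)
      then show ?thesis
        unfolding c'_def \<sigma>'_def frame_identities[symmetric]
        using new2[OF False] H0[OF k(3)] H0[OF uX] d1 by (simp add: y_def v_def)
    qed
    show "c' \<le> 0" "\<sigma>' > 0"
      using probe_direction_quadrant[OF cs q(1,2) 1 2 3] by auto
  qed
  have f: "K * cross2 d y = c' * cross2 d1 y - \<sigma>' * (d1 \<bullet> y)" for y
    unfolding K_def frame_identities(1) c'_def \<sigma>'_def by simp
  define g where "g = d1 \<bullet> (C - B)"
  have bx: "d1 \<bullet> b = - g" by (simp add: g_def b_def inner_diff_right)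
  have g: "g > 0" using q(3) s by (simp add: g_def w_def inner_diff_right)
  show ?thesis
  proof (cases "p1 \<in> V")
    case True
    \<comment> \<open>Otherwise \<open>B\<close> itself minimises \<open>cross2 d\<close>, and
      together with the first wedge this puts the polygon into the right-angled wedge at
      \<open>B\<close> with first direction \<open>- \<i> * d1\<close>.\<close>
    have fb: "0 < cross2 d b"
    proof (rule ccontr)
      assume n: "\<not> ?thesis"
      define y where "y = p1 - C"
      have l: "0 \<le> K * cross2 b y" using left[OF True] K by (simp add: b_def y_def)
      have "d1 \<bullet> (p1 - B) = d1 \<bullet> y + g" by (simp add: g_def y_def inner_diff_right)
      then have x: "d1 \<bullet> y + g \<ge> 0" using X0[of p1] V True by auto
      \<comment> \<open>Compares \<open>p1\<close> with \<open>B\<close>: both terms on the right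
        are nonnegative because \<open>p1\<close> is left of the line from \<open>C\<close> to
        \<open>B\<close> and \<open>d1 \<bullet> y + g\<close> is its first coordinate relative to
        \<open>B\<close>.\<close>
      have e: "g * (K * cross2 d y - K * cross2 d b) =
          - c' * (K * cross2 b y) + (- (K * cross2 d b)) * (d1 \<bullet> y + g)"
        unfolding f unfolding K_def frame_identities(1)[of d1 b y] bx by (simp add: algebra_simps)
      have "- c' * (K * cross2 b y) \<ge> 0" using l q'(1) by (simp add: mult_le_0_iff)
      moreover have "(- (K * cross2 d b)) * (d1 \<bullet> y + g) \<ge> 0"
        using n x K by (simp add: mult_le_0_iff)
      ultimately have "0 \<le> g * (K * cross2 d y - K * cross2 d b)" using e by linarith
      then have "K * cross2 d b \<le> K * cross2 d y" using g by (simp add: zero_le_mult_iff)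
      then have "cross2 d b \<le> cross2 d y" using K by simp
      then have Bmin: "0 \<le> cross2 d (z - B)" if "z \<in> X" for z
        using k(5)[OF that] by (simp add: b_def y_def cross2_diff)
      have F: "0 \<le> c' * cross2 d1 (z - B) - \<sigma>' * (d1 \<bullet> (z - B))" if "z \<in> X" for z
        unfolding f[symmetric] using Bmin[OF that] K by simp
      have "c' \<noteq> 0"
      proof
        assume "c' = 0"
        then have "\<sigma>' * (d1 \<bullet> (A - B)) \<le> 0" using F[OF ABC(1)] by simp
        then show False using s q'(2) by (simp add: mult_le_0_iff)
      qed
      then have cn: "c' < 0" using q' by simp
      have "\<exists>z\<in>X. (- \<i> * d1) \<bullet> (z - B) < 0 \<or> cross2 (- \<i> * d1) (z - B) < 0"
        using no_right_wedge[OF ABC(2), of "- \<i> * d1"] d1 by simp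
      then obtain z where z: "z \<in> X" "cross2 d1 (z - B) > 0 \<or> d1 \<bullet> (z - B) < 0"
        by (auto simp: cross2_alt inner_complex_def algebra_simps)
      then have "cross2 d1 (z - B) > 0" "d1 \<bullet> (z - B) \<ge> 0" using X0[of z] by linarith+
      then have "c' * cross2 d1 (z - B) < 0" "\<sigma>' * (d1 \<bullet> (z - B)) \<ge> 0"
        using cn q' by (simp_all add: mult_less_0_iff)
      then show False using F[OF z(1)] by linarith
    qed
    have "p1 = C"
    proof -
      define y where "y = p1 - C"
      have by': "0 \<le> cross2 b y" using left[OF True] by (simp add: b_def y_def)
      have yv: "0 \<le> cross2 y v" using uV[OF True] by (simp add: v_def y_def cross2_alt algebra_simps)
      have fy: "cross2 d y \<le> 0" using k(5)[OF ABC(3)] by (simp add: y_def cross2_diff)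
      have e: "cross2 b v * cross2 d y = cross2 b y * cross2 d v + cross2 y v * cross2 d b"
        by (rule cross2_pluecker)
      have "cross2 b y * cross2 d v \<ge> 0" "cross2 y v * cross2 d b \<ge> 0" "cross2 b v * cross2 d y \<le> 0"
        using by' yv fy bpos fb bv by (simp_all add: mult_le_0_iff)
      then have "cross2 b y * cross2 d v = 0" "cross2 y v * cross2 d b = 0" using e by linarith+
      then have z: "cross2 b y = 0" "cross2 y v = 0" using bpos fb by auto
      have "cross2 b v * (d1 \<bullet> y) = cross2 b y * (d1 \<bullet> v) + cross2 y v * (d1 \<bullet> b)"
        "cross2 b v * cross2 d1 y = cross2 b y * cross2 d1 v + cross2 y v * cross2 d1 b"
        by (simp_all add: cross2_alt inner_complex_def algebra_simps)
      then have "d1 \<bullet> y = 0" "cross2 d1 y = 0" using z bv by auto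
      then have "y = 0" by (rule frame_eq_0[OF d1])
      then show ?thesis by (simp add: y_def)
    qed
    \<comment> \<open>With a flush second ray \<open>C\<close> would lie on both rays, that is, be
      the apex.\<close>
    moreover have "d \<bullet> v \<noteq> 0"
      using ch(4) k(6)[OF ABC(3)] \<open>p1 = C\<close> by (auto simp: v_def cross2_def)
    moreover have "0 \<le> cross2 b (p2 - C)"
    proof -
      define y where "y = p2 - C"
      have fy: "cross2 d y \<ge> 0" using k(5)[OF k(3)] \<open>p1 = C\<close> by (simp add: y_def)
      have vy: "0 < cross2 v y" using new2 \<open>d \<bullet> v \<noteq> 0\<close> by (simp add: y_def)
      have "cross2 b y * cross2 d v = cross2 b v * cross2 d y + cross2 v y * cross2 d b"
        by (rule cross2_pluecker)
      then have "0 \<le> cross2 b y * cross2 d v" using fy vy bv fb by simp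
      then show ?thesis using bpos by (simp add: zero_le_mult_iff y_def)
    qed
    ultimately show ?thesis by (simp add: v_def b_def)
  qed simp
qed

end

section \<open>The strategy\<close>

lemma finite_argmax:
  fixes f :: "'a \<Rightarrow> real"
  assumes "finite Y" "Y \<noteq> {}"
  obtains u where "u \<in> Y" "\<And>y. y \<in> Y \<Longrightarrow> f y \<le> f u"
proof -
  have "Max (f ` Y) \<in> f ` Y" using assms by simp
  then obtain u where "u \<in> Y" "f u = Max (f ` Y)" by auto
  then show ?thesis using that assms(1) by simp
qed

fun contact_set :: "outcome \<Rightarrow> complex set" where
  "contact_set Miss = {}"
| "contact_set (Hit q H1 H2 p1 p2) = {p1, p2}"

fun second_ray :: "outcome \<Rightarrow> complex set" where
  "second_ray Miss = {}"
| "second_ray (Hit q H1 H2 p1 p2) = H2"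

fun first_contact :: "outcome \<Rightarrow> complex" where
  "first_contact Miss = 0"
| "first_contact (Hit q H1 H2 p1 p2) = p1"

definition seen :: "history \<Rightarrow> complex set" where
  "seen h = (\<Union>x\<in>set h. contact_set (snd x))"

text \<open>Edges whose supporting line was the second ray of a probe along that edge. The first
  probe is left out because its line is not spanned by two contact points.\<close>
definition confirmed :: "history \<Rightarrow> (complex \<times> complex) set" where
  "confirmed h = {(fst L + snd L, fst L) | L r. (L, r) \<in> set (tl h) \<and> fst L + snd L \<in> second_ray r}"

text \<open>Index 1 is the second probe, from \<open>A\<close> to \<open>B\<close>, so this is the
  vertex called \<open>C\<close> in the geometric lemmas.\<close>

definition pivot :: "history \<Rightarrow> complex" where
  "pivot h = first_contact (snd (h ! 1))"

definition open_gap :: "history \<Rightarrow> complex \<times> complex \<Rightarrow> bool" where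
  "open_gap h g \<longleftrightarrow> fst g \<in> seen h \<and> snd g \<in> seen h \<and> left_of_all (seen h) (fst g) (snd g) \<and> g \<notin> confirmed h"

text \<open>Gaps ending in the pivot have priority, which brings about the extra double gain; the
  choice among the others does not affect the count.\<close>

definition next_gap :: "history \<Rightarrow> complex \<times> complex" where
  "next_gap h = (SOME g. open_gap h g \<and> ((\<exists>u. open_gap h (u, pivot h)) \<longrightarrow> snd g = pivot h))"

text \<open>A gap \<open>(u, w)\<close> is probed backwards, from \<open>w\<close> towards
  \<open>u\<close>: the polygon is right of the second ray, so a flush second ray puts it left of
  the directed edge from \<open>u\<close> to \<open>w\<close>.\<close>

definition strategy :: "complex \<Rightarrow> history \<Rightarrow> action" where
  "strategy p h =
     (if h = [] then Probe (p, 1)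
      else if length h = 1 then
        (case snd (hd h) of Miss \<Rightarrow> Answer {} | Hit q H1 H2 p1 p2 \<Rightarrow> Probe (p1, p2 - p1))
      else if \<exists>g. open_gap h g then Probe (snd (next_gap h), fst (next_gap h) - snd (next_gap h))
      else Answer (seen h))"

definition progress :: "history \<Rightarrow> nat" where
  "progress h = card (seen h) + card (confirmed h)"

lemma seen_snoc: "seen (h @ [(L, r)]) = contact_set r \<union> seen h"
  by (auto simp: seen_def)

lemma confirmed_snoc:
  "h \<noteq> [] \<Longrightarrow> confirmed (h @ [(L, r)]) =
    (if fst L + snd L \<in> second_ray r then {(fst L + snd L, fst L)} else {}) \<union> confirmed h"
  by (auto simp: confirmed_def)

lemma pivot_snoc: "2 \<le> length h \<Longrightarrow> pivot (h @ [x]) = pivot h"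
  by (simp add: pivot_def nth_append)

lemma next_gap:
  assumes "open_gap h g"
  shows "open_gap h (next_gap h)" "open_gap h (u, pivot h) \<Longrightarrow> snd (next_gap h) = pivot h"
proof -
  have "\<exists>g. open_gap h g \<and> ((\<exists>u. open_gap h (u, pivot h)) \<longrightarrow> snd g = pivot h)"
  proof (cases "\<exists>u. open_gap h (u, pivot h)")
    case True
    then obtain u where "open_gap h (u, pivot h)" by blast
    then show ?thesis by (intro exI[of _ "(u, pivot h)"]) simp
  next
    case False
    then show ?thesis using assms by blast
  qed
  then have *: "open_gap h (next_gap h) \<and> ((\<exists>u. open_gap h (u, pivot h)) \<longrightarrow> snd (next_gap h) = pivot h)"
    unfolding next_gap_def by (rule someI_ex)
  show "open_gap h (next_gap h)" using * by blast
  show "snd (next_gap h) = pivot h" if "open_gap h (u, pivot h)" using * that by blast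
qed

section \<open>Invariants of the strategy and the probe count\<close>

context wide_polygon
begin

definition sound :: "history \<Rightarrow> bool" where
  "sound h \<longleftrightarrow> seen h \<subseteq> X \<and> (\<forall>(u, w)\<in>confirmed h. u \<in> X \<and> w \<in> X \<and> left_of_all X u w)"

text \<open>A strict support at \<open>u\<close> puts all other vertices into an open half-plane, so
  their directions from \<open>u\<close> are ordered by the slope \<open>f\<close>; the least slope
  gives the next point and the greatest the previous one.\<close>

lemma neighbours_exist:
  assumes V: "V \<subseteq> X" and u: "u \<in> V" and v: "v \<in> V" "v \<noteq> u"
  shows "\<exists>w\<in>V. left_of_all V u w" "\<exists>w\<in>V. left_of_all V w u"
proof -
  obtain e where e: "\<And>y. y \<in> X \<Longrightarrow> y \<noteq> u \<Longrightarrow> e \<bullet> (y - u) > 0"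
    using strict_support[of u] V u by blast
  then have e0: "e \<noteq> 0" using V v by force
  define Y f where "Y = V - {u}" and "f y = cross2 e (y - u) / (e \<bullet> (y - u))" for y
  have Y: "finite Y" "Y \<noteq> {}" using V v finite by (auto simp: Y_def intro: finite_subset)
  have ccw: "0 \<le> cross2 (y - u) (z - u)" if "f y \<le> f z" "y \<in> Y" "z \<in> Y" for y z
  proof -
    have "e \<bullet> (y - u) > 0" "e \<bullet> (z - u) > 0" using e V that by (auto simp: Y_def)
    then have "cross2 e (y - u) = f y * (e \<bullet> (y - u))" "cross2 e (z - u) = f z * (e \<bullet> (z - u))"
      "0 \<le> (e \<bullet> (y - u)) * (e \<bullet> (z - u))"
      by (simp_all add: f_def)
    then have "cross2 e (y - u) * (e \<bullet> (z - u)) \<le> cross2 e (z - u) * (e \<bullet> (y - u))"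
      using mult_right_mono[OF that(1), of "(e \<bullet> (y - u)) * (e \<bullet> (z - u))"] by (simp only: mult_ac)
    then have "0 \<le> (norm e)\<^sup>2 * cross2 (y - u) (z - u)"
      unfolding frame_identities(1) by (simp add: mult.commute)
    then show ?thesis using e0 by (simp add: zero_le_mult_iff)
  qed
  obtain w where "w \<in> Y" "\<And>y. y \<in> Y \<Longrightarrow> - f y \<le> - f w"
    using finite_argmax[OF Y, of "\<lambda>y. - f y"] by blast
  then have w: "w \<in> V" "w \<noteq> u" "0 \<le> cross2 (w - u) (y - u)" if "y \<in> V" "y \<noteq> u" for y
    using ccw that by (auto simp: Y_def)
  have "0 \<le> cross2 (w - u) (y - u)" if "y \<in> V" for y
    using w(3)[OF that] by (cases "y = u") (simp_all add: cross2_def)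
  then show "\<exists>w\<in>V. left_of_all V u w"
    unfolding left_of_all_def using w(1,2)[OF v] by (intro bexI[of _ w]) auto
  obtain w where "w \<in> Y" "\<And>y. y \<in> Y \<Longrightarrow> f y \<le> f w"
    using finite_argmax[OF Y, of f] by blast
  then have w: "w \<in> V" "w \<noteq> u" "0 \<le> cross2 (y - u) (w - u)" if "y \<in> V" "y \<noteq> u" for y
    using ccw that by (auto simp: Y_def)
  have "0 \<le> cross2 (y - u) (w - u)" if "y \<in> V" for y
    using w(3)[OF that] by (cases "y = u") (simp_all add: cross2_def)
  moreover have "cross2 (u - w) (y - w) = cross2 (y - u) (w - u)" for y
    by (simp add: cross2_alt algebra_simps)
  ultimately show "\<exists>w\<in>V. left_of_all V w u"
    unfolding left_of_all_def using w(1,2)[OF v] by (intro bexI[of _ w]) auto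
qed

text \<open>At most one edge of the polygon starts at each vertex, which bounds the confirmed edges
  by \<open>card X\<close>.\<close>

lemma progress_le:
  assumes "sound h"
  shows "progress h \<le> 2 * card X"
proof -
  have "card (seen h) \<le> card X" using assms finite by (auto simp: sound_def intro: card_mono)
  moreover have "card (confirmed h) \<le> card X"
  proof (rule card_inj_on_le[OF _ _ finite])
    show "inj_on fst (confirmed h)"
    proof (rule inj_onI)
      fix a b assume ab: "a \<in> confirmed h" "b \<in> confirmed h" "fst a = fst b"
      obtain u w w' where "a = (u, w)" "b = (u, w')" using ab(3) by (metis surjective_pairing)
      moreover from this have "u \<in> X" "w \<in> X" "w' \<in> X" "left_of_all X u w" "left_of_all X u w'"
        using assms ab by (auto simp: sound_def)
      ultimately show "a = b" using successor_unique[of u w w'] by simp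
    qed
    show "fst ` confirmed h \<subseteq> X" using assms by (auto simp: sound_def)
  qed
  ultimately show ?thesis by (simp add: progress_def)
qed

lemma sound_finite:
  assumes "sound h"
  shows "finite (seen h)" "finite (confirmed h)"
proof -
  show "finite (seen h)" using assms finite by (auto simp: sound_def intro: finite_subset)
  have "confirmed h \<subseteq> X \<times> X" using assms by (auto simp: sound_def)
  then show "finite (confirmed h)" using finite by (auto intro: finite_subset)
qed

lemma chord_step:
  assumes h: "sound h" "h \<noteq> []" and uw: "u \<in> X" "w \<in> X" "u \<noteq> w"
    and r: "valid_response (pi/2) (convex hull X) (w, u - w) r"
  obtains d p1 p2 where "contacts X (w, u - w) d p1 p2" "p1 = first_contact r" "sound (h @ [((w, u - w), r)])"
    "seen (h @ [((w, u - w), r)]) = insert p1 (insert p2 (seen h))"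
    "confirmed (h @ [((w, u - w), r)]) = (if d \<bullet> (u - w) = 0 then insert (u, w) (confirmed h) else confirmed h)"
proof -
  have "w \<in> convex hull X" using uw hull_subset[of X convex] by auto
  then obtain q H1 d p1 p2 where rr: "r = Hit q H1 (ray q (\<i> * d)) p1 p2"
    and c: "contacts X (w, u - w) d p1 p2"
    and H2: "\<And>y. y \<in> X \<Longrightarrow> y \<in> ray q (\<i> * d) \<longleftrightarrow> d \<bullet> (y - p2) = 0"
    using response_contacts[of w "u - w" r] uw r by auto
  note k = contactsD[OF c] and ch = chord_probe[OF c uw(2,1,3)]
  let ?h = "h @ [((w, u - w), r)]"
  have s: "seen ?h = insert p1 (insert p2 (seen h))" by (simp add: seen_snoc rr)
  have cf: "confirmed ?h = (if d \<bullet> (u - w) = 0 then insert (u, w) (confirmed h) else confirmed h)"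
    using confirmed_snoc[OF h(2), of "(w, u - w)" r] H2[OF uw(1)] ch(3) by (simp add: rr)
  have "left_of_all X u w" if 0: "d \<bullet> (u - w) = 0"
    unfolding left_of_all_def
  proof (intro conjI ballI)
    fix y assume y: "y \<in> X"
    have "d \<bullet> (y - w) \<ge> 0" using k(4)[OF y] ch(4) 0 by (simp add: inner_diff_right)
    then have "(norm d)\<^sup>2 * cross2 (u - w) (y - w) \<le> 0"
      unfolding frame_identities(1) 0 using ch(2) by simp
    then have "cross2 (u - w) (y - w) \<le> 0" using k(1) by (simp add: mult_le_0_iff)
    then show "0 \<le> cross2 (w - u) (y - u)" by (simp add: cross2_alt algebra_simps)
  qed (use uw in simp)
  then have "sound ?h" using h(1) k(2,3) uw unfolding sound_def s cf by auto
  with that c s cf show ?thesis by (simp add: rr)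
qed

text \<open>Either the edge gets confirmed, or \<open>p2\<close> lies strictly outside the hull of
  the seen vertices. A new \<open>p1\<close> counts in addition because it differs from
  \<open>p2\<close>.\<close>

lemma gap_step:
  assumes h: "sound h" "h \<noteq> []" and g: "open_gap h (u, w)"
    and r: "valid_response (pi/2) (convex hull X) (w, u - w) r"
  obtains d p1 p2 where "contacts X (w, u - w) d p1 p2" "sound (h @ [((w, u - w), r)])"
    "seen (h @ [((w, u - w), r)]) = insert p1 (insert p2 (seen h))"
    "confirmed (h @ [((w, u - w), r)]) = (if d \<bullet> (u - w) = 0 then insert (u, w) (confirmed h) else confirmed h)"
    "progress h + 1 \<le> progress (h @ [((w, u - w), r)])" "p1 \<in> seen h \<or> progress h + 2 \<le> progress (h @ [((w, u - w), r)])"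
proof -
  have uw: "u \<in> X" "w \<in> X" "u \<noteq> w" and gu: "left_of_all (seen h) u w" "(u, w) \<notin> confirmed h"
    using h(1) g by (auto simp: open_gap_def sound_def left_of_all_def)
  let ?h = "h @ [((w, u - w), r)]"
  obtain d p1 p2 where c: "contacts X (w, u - w) d p1 p2" and "p1 = first_contact r" and so: "sound ?h"
    and s: "seen ?h = insert p1 (insert p2 (seen h))"
    and cf: "confirmed ?h = (if d \<bullet> (u - w) = 0 then insert (u, w) (confirmed h) else confirmed h)"
    by (rule chord_step[OF h uw r])
  note ch = chord_probe[OF c uw(2,1,3)] and fin = sound_finite[OF h(1)]
  have ne: "p1 \<noteq> p2" using contacts_distinct[OF c] by simp
  have new: "p2 \<notin> seen h" if "d \<bullet> (u - w) \<noteq> 0"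
  proof
    assume "p2 \<in> seen h"
    then have "0 \<le> cross2 (w - u) (p2 - u)" using gu by (simp add: left_of_all_def)
    moreover have "0 < cross2 (u - w) (p2 - w)" using ch(1,6) that by simp
    ultimately show False by (simp add: cross2_alt algebra_simps)
  qed
  have "progress h + 1 \<le> progress ?h \<and> (p1 \<in> seen h \<or> progress h + 2 \<le> progress ?h)"
  proof (cases "d \<bullet> (u - w) = 0")
    case True
    then have "card (confirmed ?h) = card (confirmed h) + 1" using cf gu(2) fin(2) by simp
    moreover have "card (seen h) \<le> card (seen ?h)" "card (insert p1 (seen h)) \<le> card (seen ?h)"
      unfolding s using fin(1) by (auto intro!: card_mono)
    ultimately show ?thesis using fin(1) by (cases "p1 \<in> seen h") (simp_all add: progress_def)
  next
    case False
    then have "confirmed ?h = confirmed h" "p2 \<notin> insert p1 (seen h)" using cf new ne by auto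
    moreover have "seen ?h = insert p2 (insert p1 (seen h))" using s by auto
    ultimately show ?thesis using fin(1) by (cases "p1 \<in> seen h") (simp_all add: progress_def insert_absorb)
  qed
  with that c so s cf show ?thesis by blast
qed

context
  fixes ans :: "history \<Rightarrow> dline \<Rightarrow> outcome" and p :: complex
  assumes valid: "\<And>h L. valid_response (pi/2) (convex hull X) L (ans h L)"
    and p: "p \<in> convex hull X"
begin

text \<open>Every probe of a gap raises \<open>progress\<close>, which is bounded; once no gap is
  open, the successor of each seen vertex is seen and \<open>successor_closed\<close> applies. Two
  distinct seen vertices are required for neighbours to exist.\<close>

lemma strategy_finishes:
  assumes "sound h" "2 \<le> length h" "a \<in> seen h" "b \<in> seen h" "a \<noteq> b" "2 * card X \<le> progress h + k"
  shows "solves (strategy p) ans h k X"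
  using assms
proof (induction k arbitrary: h)
  have gap: "\<exists>L. strategy p h = Probe L \<and> snd L \<noteq> 0 \<and> sound (h @ [(L, ans h L)]) \<and>
      seen h \<subseteq> seen (h @ [(L, ans h L)]) \<and> progress h + 1 \<le> progress (h @ [(L, ans h L)])"
    if h: "sound h" "2 \<le> length h" and g: "open_gap h g" for h g
  proof -
    obtain u w where uw: "next_gap h = (u, w)" by fastforce
    then have gg: "open_gap h (u, w)" using next_gap(1)[OF g] by simp
    have "h \<noteq> []" using h by auto
    moreover have "\<exists>g. open_gap h g" using gg by blast
    ultimately have st: "strategy p h = Probe (w, u - w)" using h uw by (auto simp: strategy_def)
    have "u \<noteq> w" using gg by (auto simp: open_gap_def left_of_all_def)
    let ?h = "h @ [((w, u - w), ans h (w, u - w))]"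
    obtain d p1 p2 where "contacts X (w, u - w) d p1 p2" "sound ?h"
      "seen ?h = insert p1 (insert p2 (seen h))"
      "confirmed ?h = (if d \<bullet> (u - w) = 0 then insert (u, w) (confirmed h) else confirmed h)"
      "progress h + 1 \<le> progress ?h" "p1 \<in> seen h \<or> progress h + 2 \<le> progress ?h"
      by (rule gap_step[OF h(1) \<open>h \<noteq> []\<close> gg valid[of "(w, u - w)" h]])
    with st \<open>u \<noteq> w\<close> show ?thesis by auto
  qed
  have done': "strategy p h = Answer X"
    if h: "sound h" "2 \<le> length h" "a \<in> seen h" "b \<in> seen h" and g: "\<nexists>g. open_gap h g" for h
  proof -
    have "seen h = X"
    proof (rule successor_closed)
      show "seen h \<subseteq> X" "seen h \<noteq> {}" using h by (auto simp: sound_def)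
      show "\<forall>u\<in>seen h. \<exists>w\<in>seen h. left_of_all X u w"
      proof
        fix u assume u: "u \<in> seen h"
        obtain v where "v \<in> seen h" "v \<noteq> u" using h \<open>a \<noteq> b\<close> by metis
        then obtain w where w: "w \<in> seen h" "left_of_all (seen h) u w"
          using neighbours_exist(1)[of "seen h" u v] h u by (auto simp: sound_def)
        then have "(u, w) \<in> confirmed h" using g u by (auto simp: open_gap_def)
        then show "\<exists>w\<in>seen h. left_of_all X u w" using h w by (auto simp: sound_def)
      qed
    qed
    moreover have "h \<noteq> []" "length h \<noteq> 1" using h by auto
    ultimately show ?thesis using g by (simp add: strategy_def)
  qed
  {
    case 0
    have "\<nexists>g. open_gap h g"
    proof
      assume "\<exists>g. open_gap h g"
      then obtain L where "sound (h @ [(L, ans h L)])" "progress h + 1 \<le> progress (h @ [(L, ans h L)])"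
        using gap 0 by blast
      then show False using progress_le 0 by fastforce
    qed
    then show ?case using done' 0 by simp
  next
    case (Suc k)
    show ?case
    proof (cases "\<exists>g. open_gap h g")
      case True
      then obtain L where L: "strategy p h = Probe L" "snd L \<noteq> 0" "sound (h @ [(L, ans h L)])"
        "seen h \<subseteq> seen (h @ [(L, ans h L)])" "progress h + 1 \<le> progress (h @ [(L, ans h L)])"
        using gap Suc.prems by blast
      have "solves (strategy p) ans (h @ [(L, ans h L)]) k X"
        by (rule Suc.IH) (use L Suc.prems in auto)
      then show ?thesis using L by simp
    next
      case False
      then show ?thesis using done' Suc.prems by simp
    qed
  }
qed

text \<open>The budget \<open>k\<close> is one less than single gains would need. Each probe of a
  gap ending in \<open>C\<close> brings a new first contact, and with it the missing double gain, or
  preserves the invariants; as \<open>progress\<close> is bounded, the former must happen. The first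
  conjunct records that room for two items remains.\<close>

lemma pivot_phase:
  assumes "pivot_data X d1 A B d2 C"
    and "sound h" "2 \<le> length h" "pivot h = C" "{A, B, C} \<subseteq> seen h"
    and "\<And>y. y \<in> seen h \<Longrightarrow> 0 \<le> cross2 (B - C) (y - C)"
    and "\<And>u. (u, C) \<notin> confirmed h"
  shows "progress h + 2 \<le> 2 * card X \<and>
    (\<forall>k. 2 * card X \<le> progress h + k + 1 \<longrightarrow> solves (strategy p) ans h k X)"
  using assms
proof (induction "2 * card X - progress h" arbitrary: h rule: less_induct)
  case less
  note h = less.prems(2,3)
  have V: "seen h \<subseteq> X" using h by (simp add: sound_def)
  have ABC: "A \<in> seen h" "B \<in> seen h" "C \<in> seen h" using less.prems(5) by auto
  have "A \<noteq> C" "A \<noteq> B" using less.prems(1) by (auto simp: pivot_data_def cross2_def)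
  then obtain u0 where "u0 \<in> seen h" "left_of_all (seen h) u0 C"
    using neighbours_exist(2)[OF V ABC(3,1)] by blast
  then have g0: "open_gap h (u0, pivot h)"
    using ABC less.prems by (simp add: open_gap_def)
  obtain u where ng: "next_gap h = (u, C)"
    using next_gap(2)[OF g0 g0] less.prems(4) by (metis surjective_pairing)
  then have g: "open_gap h (u, C)" using next_gap(1)[OF g0] by simp
  then have u: "u \<in> seen h" "left_of_all (seen h) u C" by (auto simp: open_gap_def)
  then have uC: "u \<noteq> C" by (simp add: left_of_all_def)
  have hne: "h \<noteq> []" "length h \<noteq> 1" using h by auto
  then have st: "strategy p h = Probe (C, u - C)" using g ng by (auto simp: strategy_def)
  let ?h = "h @ [((C, u - C), ans h (C, u - C))]"
  obtain d p1 p2 where c: "contacts X (C, u - C) d p1 p2" and so: "sound ?h"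
    and s: "seen ?h = insert p1 (insert p2 (seen h))"
    and cf: "confirmed ?h = (if d \<bullet> (u - C) = 0 then insert (u, C) (confirmed h) else confirmed h)"
    and pr: "progress h + 1 \<le> progress ?h" "p1 \<in> seen h \<or> progress h + 2 \<le> progress ?h"
    by (rule gap_step[OF h(1) hne(1) g valid[of "(C, u - C)" h]])
  have solve: "solves (strategy p) ans h (Suc k) X" if "solves (strategy p) ans ?h k X" for k
    using that st uC by simp
  have le: "progress ?h \<le> 2 * card X" by (rule progress_le[OF so])
  have len: "2 \<le> length ?h" using h by simp
  from pivot_probe[OF less.prems(1) V ABC(1,2) less.prems(6) u c]
  show ?case
  proof
    assume "p1 \<notin> seen h"
    then have p2: "progress h + 2 \<le> progress ?h" using pr by simp
    show ?case
    proof (intro conjI allI impI)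
      show "progress h + 2 \<le> 2 * card X" using p2 le by simp
      fix k assume k: "2 * card X \<le> progress h + k + 1"
      \<comment> \<open>Room for two more items makes \<open>k\<close> positive, so a probe may be
        spent.\<close>
      then obtain k' where k': "k = Suc k'" using p2 le by (cases k) auto
      have "solves (strategy p) ans ?h k' X"
        using strategy_finishes[OF so len, of A B k'] s ABC \<open>A \<noteq> B\<close> k k' p2 by auto
      then show "solves (strategy p) ans h k X" using solve k' by simp
    qed
  next
    assume p1: "p1 = C \<and> d \<bullet> (u - C) \<noteq> 0 \<and> 0 \<le> cross2 (B - C) (p2 - C)"
    have IH: "progress ?h + 2 \<le> 2 * card X \<and>
      (\<forall>k. 2 * card X \<le> progress ?h + k + 1 \<longrightarrow> solves (strategy p) ans ?h k X)"
    proof (rule less.hyps)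
      show "2 * card X - progress ?h < 2 * card X - progress h" using pr le by simp
      show "pivot ?h = C" using less.prems(4) h by (simp add: pivot_snoc)
      show "{A, B, C} \<subseteq> seen ?h" using s ABC by auto
      show "0 \<le> cross2 (B - C) (y - C)" if "y \<in> seen ?h" for y
        using that s p1 less.prems(6) ABC by auto
      \<comment> \<open>The edge into \<open>C\<close> stays unconfirmed because the second ray was
        not flush.\<close>
      show "(u', C) \<notin> confirmed ?h" for u' using cf p1 less.prems(7) by simp
    qed (use less.prems so len in auto)
    show ?case
    proof (intro conjI allI impI)
      show "progress h + 2 \<le> 2 * card X" using IH pr by simp
      fix k assume k: "2 * card X \<le> progress h + k + 1"
      then obtain k' where k': "k = Suc k'" using IH pr by (cases k) auto
      then have "solves (strategy p) ans ?h k' X" using IH pr k by simp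
      then show "solves (strategy p) ans h k X" using solve k' by simp
    qed
  qed
qed

lemma strategy_solves: "solves (strategy p) ans [] (2 * card X - 3) X"
proof -
  define r0 where "r0 = ans [] (p, 1)"
  obtain q0 H1 H2 d1 A B where r0: "r0 = Hit q0 H1 H2 A B" and c1: "contacts X (p, 1) d1 A B"
    using response_contacts[OF p _ valid[of "(p, 1)" "[]"]] by (auto simp: r0_def)
  note k1 = contactsD[OF c1]
  define h1 :: history where "h1 = [((p, 1), r0)]"
  have s1: "seen h1 = {A, B}" and cf1: "confirmed h1 = {}"
    by (auto simp: seen_def confirmed_def r0 h1_def)
  have AB: "B \<noteq> A" using contacts_distinct[OF c1] by auto
  have so1: "sound h1" using k1 by (simp add: sound_def s1 cf1)
  have st1: "strategy p h1 = Probe (A, B - A)" by (simp add: strategy_def r0 h1_def)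
  define r1 where "r1 = ans h1 (A, B - A)"
  define h2 :: history where "h2 = h1 @ [((A, B - A), r1)]"
  obtain d2 C D where c2: "contacts X (A, B - A) d2 C D" and C: "C = first_contact r1" and so2: "sound h2"
    and s2: "seen h2 = insert C (insert D (seen h1))"
    and cf2: "confirmed h2 = (if d2 \<bullet> (B - A) = 0 then insert (B, A) (confirmed h1) else confirmed h1)"
    unfolding h2_def
    by (rule chord_step[OF so1 _ k1(3,2) AB, of r1]) (auto simp: r1_def h1_def intro: valid)
  note ch = chord_probe[OF c2 k1(2,3) AB] and sp = second_probe[OF c1 c2]
  have neg: "cross2 (B - A) (C - A) < 0" using sp by (simp add: pivot_data_def)
  have self: "cross2 z z = 0" "cross2 z 0 = 0" for z by (simp_all add: cross2_alt)
  have CAB: "C \<noteq> A" "C \<noteq> B" using neg self by force+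
  have CD: "C \<noteq> D" using contacts_distinct[OF c2] by auto
  have len: "2 \<le> length h2" "h2 ! 1 = ((A, B - A), r1)" by (simp_all add: h2_def h1_def)
  \<comment> \<open>The items are \<open>A\<close>, \<open>B\<close>, \<open>C\<close> and either
    the confirmed edge from \<open>B\<close> to \<open>A\<close> or a fourth vertex
    \<open>D\<close>.\<close>
  have pr: "4 \<le> progress h2"
  proof (cases "d2 \<bullet> (B - A) = 0")
    case True
    have "card {C, A, B} \<le> card (seen h2)"
      by (rule card_mono[OF sound_finite(1)[OF so2]]) (auto simp: s2 s1)
    moreover have "card {C, A, B} = 3" using CAB AB by simp
    ultimately show ?thesis unfolding progress_def using cf2 True by (simp add: cf1)
  next
    case False
    then have "0 < cross2 (B - A) (D - A)" using ch(1,6) by simp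
    then have "D \<noteq> A" "D \<noteq> B" using self by force+
    then have "card (seen h2) = 4" using CAB AB CD by (simp add: s2 s1)
    then show ?thesis by (simp add: progress_def)
  qed
  have "0 \<le> cross2 (B - C) (y - C)" if "y \<in> seen h2" for y
  proof -
    have "cross2 (B - C) (A - C) > 0" using neg by (simp add: cross2_alt algebra_simps)
    moreover have "cross2 (B - C) (B - C) = 0" "cross2 (B - C) (C - C) = 0" by (simp_all add: cross2_alt mult.commute)
    ultimately show ?thesis using that sp(2) by (auto simp: s2 s1)
  qed
  moreover have "(u, C) \<notin> confirmed h2" for u using cf2 cf1 CAB by auto
  ultimately have "\<forall>k. 2 * card X \<le> progress h2 + k + 1 \<longrightarrow> solves (strategy p) ans h2 k X"
    using pivot_phase[OF sp(1) so2] len by (simp add: pivot_def C s2 s1)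
  \<comment> \<open>Of \<open>2 * card X\<close> items four are known, and the double gain saves one
    further probe. With at least three vertices the subtraction does not truncate.\<close>
  then have "solves (strategy p) ans h2 (2 * card X - 5) X" using pr by auto
  then have "solves (strategy p) ans h1 (Suc (2 * card X - 5)) X"
    using st1 AB by (simp add: r1_def h2_def)
  then have "solves (strategy p) ans [] (Suc (Suc (2 * card X - 5))) X"
    by (simp add: strategy_def r0_def h1_def)
  moreover have "Suc (Suc (2 * card X - 5)) = 2 * card X - 3" using card_ge_3 by simp
  ultimately show ?thesis by simp
qed

end

end

section \<open>From vertex lists to the index-free polygon\<close>

lemma wide_polygon_of_ccw:
  assumes cc: "convex_polygon_ccw vs" and ang: "\<forall>i < length vs. internal_angle vs i > pi / 2"
  shows "wide_polygon (set vs)"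
proof -
  define n where "n = length vs"
  have n3: "n \<ge> 3" and dv: "distinct vs"
    and edge: "\<And>i j. i < n \<Longrightarrow> j < n \<Longrightarrow> j \<noteq> i \<Longrightarrow> j \<noteq> Suc i mod n \<Longrightarrow>
      0 < cross2 (vs ! (Suc i mod n) - vs ! i) (vs ! j - vs ! i)"
    using cc unfolding convex_polygon_ccw_def n_def by blast+
  have edge0: "0 \<le> cross2 (vs ! (Suc i mod n) - vs ! i) (vs ! j - vs ! i)" if "i < n" "j < n" for i j
  proof (cases "j = i \<or> j = Suc i mod n")
    case True
    then show ?thesis by (auto simp: cross2_alt mult.commute)
  next
    case False
    then show ?thesis using edge that by (simp add: less_imp_le)
  qed
  have pred: "(i + n - 1) mod n < n" "Suc ((i + n - 1) mod n) mod n = i" "(i + n - 1) mod n \<noteq> Suc i mod n"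
    if "i < n" for i
  proof -
    show "(i + n - 1) mod n < n" using n3 by simp
    have "Suc (i + n - 1) = i + n" using n3 by simp
    then show "Suc ((i + n - 1) mod n) mod n = i" using that by (simp add: mod_Suc_eq)
    show "(i + n - 1) mod n \<noteq> Suc i mod n"
    proof (cases i)
      case 0
      then show ?thesis using n3 by simp
    next
      case (Suc i')
      then have "i + n - 1 = i' + n" "i' < n" using n3 that by auto
      then have "(i + n - 1) mod n = i'" by simp
      moreover have "Suc i mod n \<noteq> i'"
        using Suc that n3 by (cases "Suc i = n") auto
      ultimately show ?thesis by simp
    qed
  qed
  have suc_less: "Suc i mod n < n" for i using n3 by simp
  have idx: "x \<in> set vs \<longleftrightarrow> (\<exists>i<n. x = vs ! i)" for x unfolding n_def by (metis in_set_conv_nth)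
  show ?thesis
  proof
    show "finite (set vs)" by simp
    show "3 \<le> card (set vs)" using n3 dv by (simp add: n_def distinct_card)
  next
    fix x assume "x \<in> set vs"
    then obtain i where i: "i < n" "x = vs ! i" using idx by auto
    \<comment> \<open>\<open>a\<close> and \<open>b\<close> are the neighbours of \<open>x\<close>;
      the parallel through \<open>x\<close> to the chord from \<open>a\<close> to \<open>b\<close>
      is the strict support line.\<close>
    define a b where "a = vs ! ((i + n - 1) mod n)" and "b = vs ! (Suc i mod n)"
    have *: "0 < cross2 (b - a) (y - x)" if y: "y \<in> set vs" "y \<noteq> x" for y
    proof -
      obtain j where j: "j < n" "y = vs ! j" using y idx by auto
      have ji: "j \<noteq> i" using j i y by auto
      have 1: "0 \<le> cross2 (b - x) (y - x)" "j \<noteq> Suc i mod n \<Longrightarrow> 0 < cross2 (b - x) (y - x)"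
        using edge0[OF i(1) j(1)] edge[OF i(1) j(1) ji] by (simp_all add: b_def i j)
      have 2: "0 \<le> cross2 (x - a) (y - a)" "j \<noteq> (i + n - 1) mod n \<Longrightarrow> 0 < cross2 (x - a) (y - a)"
        using edge0[OF pred(1)[OF i(1)] j(1)] edge[OF pred(1)[OF i(1)] j(1)] pred(2)[OF i(1)] ji
        by (simp_all add: a_def i j)
      have "cross2 (b - a) (y - x) = cross2 (b - x) (y - x) + cross2 (x - a) (y - a)"
        by (simp add: cross2_alt algebra_simps)
      then show ?thesis using 1 2 pred(3)[OF i(1)] by (cases "j = Suc i mod n") auto
    qed
    show "\<exists>e. \<forall>y\<in>set vs. y \<noteq> x \<longrightarrow> 0 < e \<bullet> (y - x)"
      using * by (intro exI[of _ "\<i> * (b - a)"]) (auto simp: cross2_ii)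
    fix d :: complex assume d: "d \<noteq> 0"
    have "internal_angle vs i > pi/2" using ang i by (simp add: n_def)
    then have big: "arccos (((a - x) \<bullet> (b - x)) / (norm (a - x) * norm (b - x))) > pi/2"
      by (simp add: internal_angle_def vec_angle_def Let_def a_def b_def i n_def)
    \<comment> \<open>\<open>arccos\<close> is at most a right angle on arguments from 0 to 1, so
      the quotient must be negative; a vanishing denominator would make it 0.\<close>
    have neg: "(a - x) \<bullet> (b - x) < 0"
    proof (rule ccontr)
      assume "\<not> ?thesis"
      then have "0 \<le> ((a - x) \<bullet> (b - x)) / (norm (a - x) * norm (b - x))" by simp
      moreover have "((a - x) \<bullet> (b - x)) / (norm (a - x) * norm (b - x)) \<le> 1"
        proof (cases "norm (a - x) * norm (b - x) = 0")
        case False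
        then have "norm (a - x) * norm (b - x) > 0"
          using mult_nonneg_nonneg[OF norm_ge_zero norm_ge_zero, of "a - x" "b - x"] by linarith
        then show ?thesis using norm_cauchy_schwarz[of "a - x" "b - x"] by (subst divide_le_eq_1_pos)
      next
        case True
        show ?thesis unfolding True by simp
      qed
      ultimately have "arccos (((a - x) \<bullet> (b - x)) / (norm (a - x) * norm (b - x))) \<le> pi / 2"
        by (rule arccos_le_pi2)
      then show False using big by simp
    qed
    have ab: "a \<in> set vs" "b \<in> set vs" proof -
      show "a \<in> set vs" "b \<in> set vs" using suc_less pred(1)[OF i(1)] idx unfolding a_def b_def by blast+
    qed
    \<comment> \<open>Two vectors in one right-angled wedge have a nonnegative inner product, unlike
      those from \<open>x\<close> to its two neighbours.\<close>
    show "\<exists>y\<in>set vs. d \<bullet> (y - x) < 0 \<or> cross2 d (y - x) < 0"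
    proof (rule ccontr)
      assume "\<not> ?thesis"
      then have "0 \<le> d \<bullet> (a - x)" "0 \<le> d \<bullet> (b - x)" "0 \<le> cross2 d (a - x)" "0 \<le> cross2 d (b - x)"
        using ab by (meson not_less)+
      then have "0 \<le> (norm d)\<^sup>2 * ((a - x) \<bullet> (b - x))" unfolding frame_identities(2)[of d] by simp
      then show False using neg d by (simp add: zero_le_mult_iff)
    qed
  next
    fix V assume V: "V \<subseteq> set vs" "V \<noteq> {}" and cl: "\<forall>u\<in>V. \<exists>w\<in>V. left_of_all (set vs) u w"
    \<comment> \<open>The successor supplied by \<open>cl\<close> must be the next vertex of the
      list, since otherwise that vertex and the supplied one would each lie left of the edge to the
      other.\<close>
    have step: "vs ! (Suc i mod n) \<in> V" if i: "i < n" "vs ! i \<in> V" for i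
    proof -
      obtain w where w: "w \<in> V" "left_of_all (set vs) (vs ! i) w" using cl i by blast
      then obtain j where j: "j < n" "w = vs ! j" using V(1) idx[of w] by auto
      have "j = Suc i mod n"
      proof (rule ccontr)
        assume "j \<noteq> Suc i mod n"
        moreover have "j \<noteq> i" using w j by (auto simp: left_of_all_def)
        ultimately have "0 < cross2 (vs ! (Suc i mod n) - vs ! i) (w - vs ! i)" using edge i j by simp
        moreover have "vs ! (Suc i mod n) \<in> set vs" using suc_less by (simp add: n_def)
        then have "0 \<le> cross2 (w - vs ! i) (vs ! (Suc i mod n) - vs ! i)" using w by (simp add: left_of_all_def)
        ultimately show False by (simp add: cross2_alt mult.commute)
      qed
      then show ?thesis using w j by simp
    qed
    obtain x where "x \<in> V" using V(2) by auto
    moreover from this have "x \<in> set vs" using V(1) by auto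
    ultimately obtain i0 where i0: "i0 < n" "vs ! i0 \<in> V" using idx[of x] by auto
    have all: "vs ! ((i0 + k) mod n) \<in> V" for k
    proof (induction k)
      case 0
      then show ?case using i0 by simp
    next
      case (Suc k)
      then show ?case using step[of "(i0 + k) mod n"] n3 by (simp add: mod_Suc_eq)
    qed
    have "vs ! j \<in> V" if "j < n" for j
    proof -
      have "(i0 + (j + n - i0)) mod n = j" using i0 that by simp
      then show ?thesis using all[of "j + n - i0"] by simp
    qed
    then have "set vs \<subseteq> V" using idx by auto
    then show "V = set vs" using V(1) by (rule subset_antisym[rotated])
  qed
qed

theorem theorem4p4:
  "\<exists>S :: complex \<Rightarrow> complex \<Rightarrow> real \<Rightarrow> history \<Rightarrow> action.
     \<forall>(vs :: complex list) (Ob :: complex set) (p :: complex) (c :: complex) (r :: real)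
       (ans :: history \<Rightarrow> dline \<Rightarrow> outcome).
       convex_polygon_ccw vs \<longrightarrow>
       (\<forall>i < length vs. internal_angle vs i > pi / 2) \<longrightarrow>
       Ob = convex hull (set vs) \<longrightarrow>
       p \<in> Ob \<longrightarrow> Ob \<subseteq> cball c r \<longrightarrow>
       (\<forall>h L. valid_response (pi / 2) Ob L (ans h L)) \<longrightarrow>
       solves (S p c r) ans [] (2 * length vs - 3) (set vs)"
proof (intro exI[of _ "\<lambda>p c r. strategy p"] allI impI)
  fix vs :: "complex list" and Ob :: "complex set" and p c :: complex and r :: real
    and ans :: "history \<Rightarrow> dline \<Rightarrow> outcome"
  assume cc: "convex_polygon_ccw vs" and ang: "\<forall>i < length vs. internal_angle vs i > pi / 2"
    and Ob: "Ob = convex hull (set vs)" and p: "p \<in> Ob"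
    and ans: "\<forall>h L. valid_response (pi / 2) Ob L (ans h L)"
  interpret wide_polygon "set vs" using wide_polygon_of_ccw[OF cc ang] .
  have "solves (strategy p) ans [] (2 * card (set vs) - 3) (set vs)"
    by (rule strategy_solves) (use ans p Ob in auto)
  moreover have "card (set vs) = length vs" using cc by (simp add: convex_polygon_ccw_def distinct_card)
  ultimately show "solves (strategy p) ans [] (2 * length vs - 3) (set vs)" by simp
qed

end
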